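(* Let $C\rightrightarrows X$ be a Lie category. The subset of regular arrows of $C$ is open in $C$.
   Context: A Lie category $C\rightrightarrows X$ is a small category whose set of arrows $C$ is a smooth manifold with or without boundary and whose set of objects $X$ is a smooth manifold without boundary, such that: the source and target maps $s,t\colon C\to X$ are smooth submersions; the unit map $u\colon X\to C$, $x\mapsto 1_x$, and the composition map $m\colon C^{(2)}\to C$, $(g,h)\mapsto gh$, are smooth, where $C^{(2)}=\{(g,h)\in C\times C: s(g)=t(h)\}$; and, if $C$ has a boundary, the restrictions $s|_{\partial C},t|_{\partial C}\colon\partial C\to X$ are also submersions (then $C^{(2)}\subset C\times C$ is a submanifold with corners and all fibres $C_x=s^{-1}(x)$, $C^x=t^{-1}(x)$ are submanifolds of $C$). For $g\in C$ the left and right translations are $L_g\colon C^{s(g)}\to C^{t(g)}$, $h\mapsto gh$, and $R_g\colon C_{t(g)}\to C_{s(g)}$, $h\mapsto hg$. The left and right rank of $g$ are $\operatorname{rank}^L(g)=\operatorname{rank}\,d(L_g)_{1_{s(g)}}$ and $\operatorname{rank}^R(g)=\operatorname{rank}\,d(R_g)_{1_{t(g)}}$. The arrow $g$ is regular (has full rank) if $\operatorname{rank}^L(g)=\operatorname{rank}^R(g)=\dim C-\dim X$. *)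

theory Defs
  imports "HOL-Analysis.Analysis"
begin

section \<open>Smooth maps between subsets of Euclidean spaces\<close>

primrec Ck_on :: "nat \<Rightarrow> 'a::euclidean_space set \<Rightarrow> ('a \<Rightarrow> 'b::euclidean_space) \<Rightarrow> bool" where
  "Ck_on 0 U f \<longleftrightarrow> continuous_on U f"
| "Ck_on (Suc k) U f \<longleftrightarrow> (\<forall>x\<in>U. f differentiable (at x)) \<and>
     (\<forall>v. Ck_on k U (\<lambda>x. frechet_derivative f (at x) v))"

text \<open>Smoothness on an arbitrary set means that there are local smooth extensions to open
  subsets of the ambient Euclidean space.\<close>

definition smooth_on :: "'a::euclidean_space set \<Rightarrow> ('a \<Rightarrow> 'b::euclidean_space) \<Rightarrow> bool" where
  "smooth_on S f \<longleftrightarrow> (\<forall>x\<in>S. \<exists>U g. open U \<and> x \<in> U \<and> (\<forall>k. Ck_on k U g) \<and> (\<forall>y\<in>S \<inter> U. f y = g y))"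


section \<open>Smooth manifolds with or without boundary\<close>

text \<open>A manifold is given by its underlying space, its dimension, and a (not necessarily maximal)
  atlas. A chart is a pair of its domain and the coordinate map. The coordinates of a chart
  live in a linear subspace of the type \<open>'e\<close>, which may depend on the chart; thus the
  dimension is a natural number between \<open>0\<close> and \<open>DIM('e)\<close>, and submanifolds and boundaries are
  manifolds over the same types.\<close>

record ('a, 'e) manifold =
  mtop :: "'a topology"
  mdim :: nat
  atlas :: "('a set \<times> ('a \<Rightarrow> 'e)) set"

abbreviation points :: "('a, 'e, 'z) manifold_scheme \<Rightarrow> 'a set" where
  "points M \<equiv> topspace (mtop M)"

text \<open>For \<open>\<nu> = 0\<close> this is the whole subspace \<open>V\<close>, so interior charts need no separate treatment.\<close>

definition half_space :: "'e::euclidean_space set \<Rightarrow> 'e \<Rightarrow> 'e set" where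
  "half_space V \<nu> = {v \<in> V. 0 \<le> v \<bullet> \<nu>}"

definition chart :: "'a topology \<Rightarrow> nat \<Rightarrow> 'a set \<Rightarrow> ('a \<Rightarrow> 'e::euclidean_space) \<Rightarrow> bool" where
  "chart T n U \<phi> \<longleftrightarrow> openin T U \<and>
     homeomorphic_map (subtopology T U) (top_of_set (\<phi> ` U)) \<phi> \<and>
     (\<exists>V \<nu>. subspace V \<and> dim V = n \<and> \<nu> \<in> V \<and> openin (top_of_set (half_space V \<nu>)) (\<phi> ` U))"

definition smooth_manifold :: "('a, 'e::euclidean_space) manifold \<Rightarrow> bool" where
  "smooth_manifold M \<longleftrightarrow>
     Hausdorff_space (mtop M) \<and> second_countable (mtop M) \<and>
     (\<forall>(U, \<phi>)\<in>atlas M. chart (mtop M) (mdim M) U \<phi>) \<and>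
     (\<Union>(U, \<phi>)\<in>atlas M. U) = points M \<and>
     (\<forall>(U, \<phi>)\<in>atlas M. \<forall>(W, \<psi>)\<in>atlas M. smooth_on (\<phi> ` (U \<inter> W)) (\<psi> \<circ> inv_into U \<phi>))"

definition boundary_points :: "('a, 'e::euclidean_space) manifold \<Rightarrow> 'a set" where
  "boundary_points M = {p. \<exists>(U, \<phi>)\<in>atlas M. p \<in> U \<and>
     (\<exists>V \<nu>. subspace V \<and> dim V = mdim M \<and> \<nu> \<in> V \<and> \<nu> \<noteq> 0 \<and>
        openin (top_of_set (half_space V \<nu>)) (\<phi> ` U) \<and> \<phi> p \<bullet> \<nu> = 0)}"

definition boundary_manifold :: "('a, 'e::euclidean_space) manifold \<Rightarrow> ('a, 'e) manifold" where
  "boundary_manifold M =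
     \<lparr> mtop = subtopology (mtop M) (boundary_points M), mdim = mdim M - 1,
       atlas = (\<lambda>(U, \<phi>). (U \<inter> boundary_points M, \<phi>)) ` atlas M \<rparr>"

text \<open>If both factors have boundary, the product has corners and is not a \<^const>\<open>smooth_manifold\<close>;
  its charts are nevertheless all that is needed to speak about smooth maps.\<close>

definition product_manifold ::
  "('a, 'e::euclidean_space) manifold \<Rightarrow> ('b, 'f::euclidean_space) manifold \<Rightarrow> ('a \<times> 'b, 'e \<times> 'f) manifold"
  where
  "product_manifold M N =
     \<lparr> mtop = prod_topology (mtop M) (mtop N), mdim = mdim M + mdim N,
       atlas = {(U \<times> W, map_prod \<phi> \<psi>) | U \<phi> W \<psi>. (U, \<phi>) \<in> atlas M \<and> (W, \<psi>) \<in> atlas N} \<rparr>"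


section \<open>Smooth maps between manifolds and their differentials\<close>

definition smooth_map_on ::
  "('a, 'e::euclidean_space) manifold \<Rightarrow> 'a set \<Rightarrow> ('b, 'f::euclidean_space) manifold \<Rightarrow> ('a \<Rightarrow> 'b) \<Rightarrow> bool"
  where
  "smooth_map_on M S N f \<longleftrightarrow>
     continuous_map (subtopology (mtop M) S) (mtop N) f \<and>
     (\<forall>(U, \<phi>)\<in>atlas M. \<forall>(W, \<psi>)\<in>atlas N.
        smooth_on (\<phi> ` {x \<in> U \<inter> S. f x \<in> W}) (\<psi> \<circ> f \<circ> inv_into U \<phi>))"

abbreviation smooth_map ::
  "('a, 'e::euclidean_space) manifold \<Rightarrow> ('b, 'f::euclidean_space) manifold \<Rightarrow> ('a \<Rightarrow> 'b) \<Rightarrow> bool"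
  where
  "smooth_map M N f \<equiv> smooth_map_on M (points M) N f"

definition chart_at :: "('a, 'e) manifold \<Rightarrow> 'a \<Rightarrow> 'a set \<times> ('a \<Rightarrow> 'e)" where
  "chart_at M p = (SOME c. c \<in> atlas M \<and> p \<in> fst c)"

text \<open>The rank of the differential of a smooth map at \<open>p\<close>, computed in charts around \<open>p\<close> and
  \<open>f p\<close>; by the chain rule it does not depend on the charts. The tangent space at \<open>p\<close> is, in the
  chart \<open>\<phi>\<close>, the linear subspace that carries the coordinates; it is the span of \<open>\<phi> ` U\<close> because
  \<open>\<phi> ` U\<close> is nonempty and open in a half space of that subspace. The derivative within
  \<open>\<phi> ` U\<close> is uniquely determined on this subspace.\<close>

definition diff_rank ::
  "('a, 'e::euclidean_space) manifold \<Rightarrow> ('b, 'f::euclidean_space) manifold \<Rightarrow> ('a \<Rightarrow> 'b) \<Rightarrow> 'a \<Rightarrow> nat"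
  where
  "diff_rank M N f p =
     (let (U, \<phi>) = chart_at M p; (W, \<psi>) = chart_at N (f p)
      in dim (frechet_derivative (\<psi> \<circ> f \<circ> inv_into U \<phi>) (at (\<phi> p) within \<phi> ` {x \<in> U. f x \<in> W})
                ` span (\<phi> ` U)))"

definition submersion ::
  "('a, 'e::euclidean_space) manifold \<Rightarrow> ('b, 'f::euclidean_space) manifold \<Rightarrow> ('a \<Rightarrow> 'b) \<Rightarrow> bool"
  where
  "submersion M N f \<longleftrightarrow> smooth_map M N f \<and> (\<forall>p\<in>points M. diff_rank M N f p = mdim N)"

definition immersion ::
  "('a, 'e::euclidean_space) manifold \<Rightarrow> ('b, 'f::euclidean_space) manifold \<Rightarrow> ('a \<Rightarrow> 'b) \<Rightarrow> bool"
  where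
  "immersion M N f \<longleftrightarrow> smooth_map M N f \<and> (\<forall>p\<in>points M. diff_rank M N f p = mdim M)"

text \<open>A \<open>k\<close>-dimensional embedded submanifold of \<open>M\<close>: the subspace topology on \<open>S\<close> together with all
  charts in which the inclusion into \<open>M\<close> is a smooth immersion.\<close>

definition submanifold :: "('a, 'e::euclidean_space) manifold \<Rightarrow> nat \<Rightarrow> 'a set \<Rightarrow> ('a, 'e) manifold" where
  "submanifold M k S =
     \<lparr> mtop = subtopology (mtop M) S, mdim = k,
       atlas = {(W, \<psi>). chart (subtopology (mtop M) S) k W \<psi> \<and>
         immersion \<lparr> mtop = subtopology (mtop M) W, mdim = k, atlas = {(W, \<psi>)} \<rparr> M (\<lambda>x. x)} \<rparr>"


section \<open>Lie categories\<close>

text \<open>The composite \<open>m g h\<close> is meaningful only if \<open>s g = t h\<close>.\<close>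

locale small_category =
  fixes A :: "'c set" and Ob :: "'x set"
    and s t :: "'c \<Rightarrow> 'x" and u :: "'x \<Rightarrow> 'c" and m :: "'c \<Rightarrow> 'c \<Rightarrow> 'c"
  assumes source_in: "g \<in> A \<Longrightarrow> s g \<in> Ob"
    and target_in: "g \<in> A \<Longrightarrow> t g \<in> Ob"
    and unit_in: "x \<in> Ob \<Longrightarrow> u x \<in> A"
    and source_unit: "x \<in> Ob \<Longrightarrow> s (u x) = x"
    and target_unit: "x \<in> Ob \<Longrightarrow> t (u x) = x"
    and comp_in: "\<lbrakk>g \<in> A; h \<in> A; s g = t h\<rbrakk> \<Longrightarrow> m g h \<in> A"
    and source_comp: "\<lbrakk>g \<in> A; h \<in> A; s g = t h\<rbrakk> \<Longrightarrow> s (m g h) = s h"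
    and target_comp: "\<lbrakk>g \<in> A; h \<in> A; s g = t h\<rbrakk> \<Longrightarrow> t (m g h) = t g"
    and comp_assoc: "\<lbrakk>g \<in> A; h \<in> A; k \<in> A; s g = t h; s h = t k\<rbrakk> \<Longrightarrow> m (m g h) k = m g (m h k)"
    and unit_left: "g \<in> A \<Longrightarrow> m (u (t g)) g = g"
    and unit_right: "g \<in> A \<Longrightarrow> m g (u (s g)) = g"

text \<open>Smoothness of the composition is smoothness on a subset of \<open>C \<times> C\<close>, which agrees with
  smoothness for the structure of an embedded submanifold with corners on that subset.\<close>

locale lie_category =
  small_category "points C" "points X" s t u m
  for C :: "('c, 'e::euclidean_space) manifold" and X :: "('x, 'f::euclidean_space) manifold"
    and s t :: "'c \<Rightarrow> 'x" and u :: "'x \<Rightarrow> 'c" and m :: "'c \<Rightarrow> 'c \<Rightarrow> 'c" +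
  assumes arrows_manifold: "smooth_manifold C"
    and objects_manifold: "smooth_manifold X"
    and objects_no_boundary: "boundary_points X = {}"
    and source_submersion: "submersion C X s"
    and target_submersion: "submersion C X t"
    and source_boundary_submersion: "submersion (boundary_manifold C) X s"
    and target_boundary_submersion: "submersion (boundary_manifold C) X t"
    and unit_smooth: "smooth_map X C u"
    and comp_smooth: "smooth_map_on (product_manifold C C)
      {(g, h). g \<in> points C \<and> h \<in> points C \<and> s g = t h} C (\<lambda>(g, h). m g h)"
begin

definition source_fibre :: "'x \<Rightarrow> ('c, 'e) manifold" where
  "source_fibre x = submanifold C (mdim C - mdim X) {g \<in> points C. s g = x}"

definition target_fibre :: "'x \<Rightarrow> ('c, 'e) manifold" where
  "target_fibre x = submanifold C (mdim C - mdim X) {g \<in> points C. t g = x}"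

definition left_rank :: "'c \<Rightarrow> nat" where
  "left_rank g = diff_rank (target_fibre (s g)) (target_fibre (t g)) (\<lambda>h. m g h) (u (s g))"

definition right_rank :: "'c \<Rightarrow> nat" where
  "right_rank g = diff_rank (source_fibre (t g)) (source_fibre (s g)) (\<lambda>h. m h g) (u (t g))"

definition regular :: "'c \<Rightarrow> bool" where
  "regular g \<longleftrightarrow> left_rank g = mdim C - mdim X \<and> right_rank g = mdim C - mdim X"

end

end

theory Submission
  imports Defs
begin

text \<open>An arrow \<open>g\<close> is regular if the differentials of its two translations, at
the units, are injective on the tangent spaces of the fibres. Injectivity of a linear map is an
open condition, but here the space on which the map is defined varies with \<open>g\<close>. This
is remedied by a linear algebra trick: the tangent space of the target fibre at the unit
\<open>1\<close> of the source of \<open>g\<close> is the kernel of the differential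
\<open>dt\<close> of the target map, so the differential of the left translation is injective on
it if and only if the pair of \<open>dt\<close> and the partial differential of the composition at
\<open>(g, 1)\<close> is injective on the whole tangent space of \<open>C\<close> at
\<open>1\<close> (\<open>left_rank_full_iff\<close>). In a chart this tangent space is a fixed
vector space, and the pair depends continuously on \<open>g\<close>, so that the arrows of full
left rank form an open set (\<open>openin_full_left_rank\<close>). The arrows of full right rank
are those of full left rank in the opposite category, and the regular arrows are the intersection
of both sets.

Three ingredients make this precise for ranks that are computed in the charts of the fibres.

\<^item> Such charts have to exist (\<open>fibre_chart_exists\<close>), also where the fibre meets
the boundary of \<open>C\<close>. There the target map is a submersion on the boundary as well;
hence the target map can be straightened by a local diffeomorphism that moves points only parallel
to the boundary (\<open>straighten_submersion\<close>), and the fibre becomes a half space in the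
kernel of the differential. This rests on a smooth inverse function theorem
(\<open>smooth_inverse_function\<close>) and on the fact that the boundary looks the same in all
charts (\<open>boundary_point_in_chart\<close>).

\<^item> The rank must not depend on the charts (\<open>diff_rank_chart\<close>). The coordinates
of a chart fill only a piece of a half space in a subspace; derivatives are unique on that
subspace because it has sufficiently many rays inside the image of the chart
(\<open>derivative_of_constant_tangential\<close>).

\<^item> The composition is smooth as a map into \<open>C\<close>, whereas the rank is that of a
map between fibres. Its derivative in fibre charts exists because the inclusion of a fibre is an
immersion (\<open>has_derivative_lift\<close>).\<close>

section \<open>Calculus of maps of class C^k\<close>

text \<open>The derivative of a composition applies a linear map that depends on the point to a
vector that depends on the point. Expanding the vector in the basis turns this into a finite sum
of products of scalar functions with derivatives in fixed directions, and these are the objects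
that \<^const>\<open>Ck_on\<close> speaks about.\<close>

lemma linear_expand_Basis:
  fixes f :: "'a::euclidean_space \<Rightarrow> 'b::real_vector"
  assumes "linear f"
  shows "f w = (\<Sum>b\<in>Basis. (w \<bullet> b) *\<^sub>R f b)"
  by (subst euclidean_representation[of w, symmetric])
    (simp add: linear_sum[OF assms] linear_scale[OF assms])

lemma Ck_on_cong:
  assumes "open U" "\<And>x. x \<in> U \<Longrightarrow> f x = g x" "Ck_on k U f"
  shows "Ck_on k U g"
  using assms(2,3)
proof (induction k arbitrary: f g)
  case 0
  then show ?case by (simp cong: continuous_on_cong)
next
  case (Suc k)
  have d: "g differentiable at x" if "x \<in> U" for x
    using Suc.prems that assms(1) unfolding differentiable_def Ck_on.simps
    by (metis has_derivative_transform_within_open)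
  have e: "frechet_derivative f (at x) = frechet_derivative g (at x)" if "x \<in> U" for x
    using Suc.prems that assms(1) frechet_derivative_transform_within_open[of f x U g] by auto
  have "Ck_on k U (\<lambda>x. frechet_derivative g (at x) v)" for v
    by (rule Suc.IH[of "\<lambda>x. frechet_derivative f (at x) v"]) (use e Suc.prems in auto)
  with d show ?case by simp
qed

text \<open>This replaces the choice operator in \<^const>\<open>frechet_derivative\<close> by a
derivative that is known explicitly; all closure properties below are proved through it, by
induction on \<open>k\<close>.\<close>

lemma Ck_on_SucI:
  assumes "open U" "\<And>x. x \<in> U \<Longrightarrow> (f has_derivative f' x) (at x)"
    "\<And>v. Ck_on k U (\<lambda>x. f' x v)"
  shows "Ck_on (Suc k) U f"
proof -
  have "frechet_derivative f (at x) = f' x" if "x \<in> U" for x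
    using frechet_derivative_at[OF assms(2)[OF that]] by simp
  then have "Ck_on k U (\<lambda>x. frechet_derivative f (at x) v)" for v
    by (intro Ck_on_cong[OF assms(1) _ assms(3)[of v]]) auto
  then show ?thesis using assms(2) by (auto simp: differentiable_def)
qed

lemma Ck_on_SucD: "Ck_on (Suc k) U f \<Longrightarrow> Ck_on k U f"
proof (induction k arbitrary: f)
  case 0
  then show ?case
    by (auto intro!: continuous_at_imp_continuous_on differentiable_imp_continuous_within)
next
  case (Suc k)
  from Suc.prems have "\<forall>x\<in>U. f differentiable at x"
    and 1: "\<And>v. Ck_on (Suc k) U (\<lambda>x. frechet_derivative f (at x) v)" by (auto simp del: Ck_on.simps simp: Ck_on.simps(2)[of "Suc k"])
  with Suc.IH[OF 1] show ?case by simp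
qed

lemma Ck_on_subset: "Ck_on k U f \<Longrightarrow> W \<subseteq> U \<Longrightarrow> Ck_on k W f"
  by (induction k arbitrary: f) (auto intro: continuous_on_subset)

lemma Ck_on_const: "open U \<Longrightarrow> Ck_on k U (\<lambda>x. c)"
proof (induction k arbitrary: c)
  case (Suc k)
  show ?case by (rule Ck_on_SucI[where f'="\<lambda>x v. 0"]) (use Suc in auto)
qed auto

lemma Ck_on_bounded_linear:
  assumes "open U" "bounded_linear L"
  shows "Ck_on k U f \<Longrightarrow> Ck_on k U (\<lambda>x. L (f x))"
proof (induction k arbitrary: f)
  case 0
  then show ?case using bounded_linear.continuous_on[OF assms(2)] by auto
next
  case (Suc k)
  show ?case
  proof (rule Ck_on_SucI[OF assms(1)])
    show "((\<lambda>x. L (f x)) has_derivative (\<lambda>v. L (frechet_derivative f (at x) v))) (at x)" if "x \<in> U" for x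
      using bounded_linear.has_derivative[OF assms(2)] Suc.prems that
      by (auto simp: frechet_derivative_works)
  qed (use Suc in auto)
qed

lemma Ck_on_id: "open U \<Longrightarrow> Ck_on k U (\<lambda>x. x)"
proof (cases k)
  case (Suc k)
  assume U: "open U"
  show ?thesis unfolding Suc
    by (rule Ck_on_SucI[where f'="\<lambda>x v. v"]) (use U in \<open>auto simp: Ck_on_const\<close>)
qed auto

lemma Ck_on_linear:
  fixes L :: "'a::euclidean_space \<Rightarrow> 'b::euclidean_space"
  shows "open U \<Longrightarrow> linear L \<Longrightarrow> Ck_on k U L"
  using Ck_on_bounded_linear[OF _ _ Ck_on_id, of U L k] by (auto simp: linear_conv_bounded_linear)

lemma Ck_on_add:
  assumes "open U"
  shows "Ck_on k U f \<Longrightarrow> Ck_on k U g \<Longrightarrow> Ck_on k U (\<lambda>x. f x + g x)"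
proof (induction k arbitrary: f g)
  case 0
  then show ?case by (auto intro: continuous_intros)
next
  case (Suc k)
  show ?case
  proof (rule Ck_on_SucI[OF assms])
    show "((\<lambda>x. f x + g x) has_derivative
        (\<lambda>v. frechet_derivative f (at x) v + frechet_derivative g (at x) v)) (at x)" if "x \<in> U" for x
      using Suc.prems that by (auto simp: frechet_derivative_works intro!: has_derivative_add)
  qed (use Suc in auto)
qed

lemma Ck_on_sum:
  assumes "open U" "\<And>i. i \<in> I \<Longrightarrow> Ck_on k U (f i)"
  shows "Ck_on k U (\<lambda>x. \<Sum>i\<in>I. f i x)"
  using assms(2)
  by (induction I rule: infinite_finite_induct)
    (auto intro: Ck_on_const[OF assms(1)] Ck_on_add[OF assms(1)])

lemma Ck_on_scaleR:
  fixes f :: "'a::euclidean_space \<Rightarrow> real"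
  assumes "open U"
  shows "Ck_on k U f \<Longrightarrow> Ck_on k U g \<Longrightarrow> Ck_on k U (\<lambda>x. f x *\<^sub>R g x)"
proof (induction k arbitrary: f g)
  case 0
  then show ?case by (auto intro: continuous_intros)
next
  case (Suc k)
  note lower = Suc.prems[THEN Ck_on_SucD]
  show ?case
  proof (rule Ck_on_SucI[OF assms])
    show "((\<lambda>x. f x *\<^sub>R g x) has_derivative
        (\<lambda>v. f x *\<^sub>R frechet_derivative g (at x) v + frechet_derivative f (at x) v *\<^sub>R g x)) (at x)"
      if "x \<in> U" for x
      using Suc.prems that by (auto simp: frechet_derivative_works intro!: has_derivative_scaleR)
  qed (use Suc lower in \<open>auto intro!: Ck_on_add assms\<close>)
qed

lemma Ck_on_compose:
  assumes "open U" "open W"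
  shows "Ck_on k U g \<Longrightarrow> Ck_on k W f \<Longrightarrow> g ` U \<subseteq> W \<Longrightarrow> Ck_on k U (\<lambda>x. f (g x))"
proof (induction k arbitrary: f)
  case 0
  then show ?case using continuous_on_compose2 by auto
next
  case (Suc k)
  note lower = Suc.prems(1)[THEN Ck_on_SucD]
  let ?D = "\<lambda>x v. frechet_derivative f (at (g x)) (frechet_derivative g (at x) v)"
  have lin: "linear (frechet_derivative f (at y))" if "y \<in> W" for y
    using Suc.prems that by (auto intro: linear_frechet_derivative)
  show ?case
  proof (rule Ck_on_SucI[OF assms(1)])
    show "((\<lambda>x. f (g x)) has_derivative ?D x) (at x)" if "x \<in> U" for x
      using Suc.prems that has_derivative_compose[of g "frechet_derivative g (at x)" x UNIV f
          "frechet_derivative f (at (g x))"] by (auto simp: frechet_derivative_works)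
  next
    fix v
    show "Ck_on k U (\<lambda>x. ?D x v)"
    proof (rule Ck_on_cong[OF assms(1)])
      show "(\<Sum>b\<in>Basis. (frechet_derivative g (at x) v \<bullet> b) *\<^sub>R frechet_derivative f (at (g x)) b) = ?D x v"
        if "x \<in> U" for x
        using that Suc.prems(3) lin by (intro linear_expand_Basis[symmetric]) auto
      show "Ck_on k U (\<lambda>x. \<Sum>b\<in>Basis. (frechet_derivative g (at x) v \<bullet> b) *\<^sub>R frechet_derivative f (at (g x)) b)"
        using Suc.prems lower
        by (intro Ck_on_sum Ck_on_scaleR assms Ck_on_bounded_linear[OF assms(1) bounded_linear_inner_left]
            Suc.IH) auto
    qed
  qed
qed

text \<open>Where a differentiable scalar factor vanishes, the product rule needs only continuity
of the other factor. This is what makes the inverse of a differentiable family of linear maps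
differentiable (next lemma): there the other factor is the inverse family itself, whose
differentiability is yet to be shown.\<close>

lemma has_derivative_scaleR_at_zero:
  fixes \<phi> :: "'a::real_normed_vector \<Rightarrow> real" and \<beta> :: "'a \<Rightarrow> 'b::real_normed_vector"
  assumes \<phi>: "(\<phi> has_derivative \<phi>') (at x)" "\<phi> x = 0" and \<beta>: "isCont \<beta> x"
  shows "((\<lambda>y. \<phi> y *\<^sub>R \<beta> y) has_derivative (\<lambda>h. \<phi>' h *\<^sub>R \<beta> x)) (at x)"
proof -
  have 1: "((\<lambda>y. \<phi> y *\<^sub>R \<beta> x) has_derivative (\<lambda>h. \<phi>' h *\<^sub>R \<beta> x)) (at x)"
    by (rule has_derivative_scaleR_left[OF \<phi>(1)])
  obtain B where B: "B > 0" "\<And>h. norm (\<phi>' h) \<le> norm h * B"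
    using bounded_linear.pos_bounded[OF has_derivative_bounded_linear[OF \<phi>(1)]] by auto
  have 2: "((\<lambda>y. \<phi> y *\<^sub>R (\<beta> y - \<beta> x)) has_derivative (\<lambda>h. 0)) (at x)"
    unfolding has_derivative_at_alt
  proof (intro conjI allI impI)
    fix e :: real assume e: "e > 0"
    obtain d1 where d1: "d1 > 0" "\<And>y. norm (y - x) < d1 \<Longrightarrow> norm (\<phi> y - \<phi> x - \<phi>' (y - x)) \<le> 1 * norm (y - x)"
      using \<phi>(1) unfolding has_derivative_at_alt by (meson zero_less_one)
    have "e / (B + 1) > 0" using e B by simp
    then obtain d2 where d2: "d2 > 0" "\<And>y. norm (y - x) < d2 \<Longrightarrow> norm (\<beta> y - \<beta> x) < e / (B + 1)"
      using \<beta> unfolding continuous_at_eps_delta dist_norm by metis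
    show "\<exists>d>0. \<forall>y. norm (y - x) < d \<longrightarrow>
        norm (\<phi> y *\<^sub>R (\<beta> y - \<beta> x) - \<phi> x *\<^sub>R (\<beta> x - \<beta> x) - 0) \<le> e * norm (y - x)"
    proof (intro exI[of _ "min d1 d2"] conjI allI impI)
      fix y assume y: "norm (y - x) < min d1 d2"
      have "\<bar>\<phi> y\<bar> \<le> norm (\<phi> y - \<phi> x - \<phi>' (y - x)) + norm (\<phi>' (y - x))"
        using \<phi>(2) by simp
      also have "\<dots> \<le> (B + 1) * norm (y - x)"
        using d1(2)[of y] B(2)[of "y - x"] y by (simp add: algebra_simps)
      finally have "norm (\<phi> y *\<^sub>R (\<beta> y - \<beta> x)) \<le> ((B + 1) * norm (y - x)) * (e / (B + 1))"
        unfolding norm_scaleR using d2(2)[of y] y B(1) by (intro mult_mono) auto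
      also have "\<dots> = e * norm (y - x)" using B(1) by simp
      finally show "norm (\<phi> y *\<^sub>R (\<beta> y - \<beta> x) - \<phi> x *\<^sub>R (\<beta> x - \<beta> x) - 0) \<le> e * norm (y - x)"
        by simp
    qed (use d1 d2 in auto)
  qed auto
  have "((\<lambda>y. \<phi> y *\<^sub>R \<beta> x + \<phi> y *\<^sub>R (\<beta> y - \<beta> x)) has_derivative (\<lambda>h. \<phi>' h *\<^sub>R \<beta> x + 0)) (at x)"
    by (rule has_derivative_add[OF 1 2])
  then show ?thesis by (simp add: algebra_simps)
qed

text \<open>Inverting linear maps preserves smoothness: from \<open>B y v - B x v = - B y (A y (B
x v) - A x (B x v))\<close> the family \<open>B\<close> is continuous, since its norms are bounded
by \<open>2\<close>, and then differentiable with derivative \<open>- B x (A' (B x v) x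
h)\<close>. This derivative is built from \<open>B\<close> and the derivative of \<open>A\<close>,
so that the order of differentiability can be raised step by step.\<close>

lemma Ck_on_inverse_family:
  fixes A B :: "'a::euclidean_space \<Rightarrow> 'b::euclidean_space \<Rightarrow> 'b"
  assumes "open U"
    and A: "\<And>x. x \<in> U \<Longrightarrow> linear (A x)"
    and BA: "\<And>x v. x \<in> U \<Longrightarrow> B x (A x v) = v" and AB: "\<And>x v. x \<in> U \<Longrightarrow> A x (B x v) = v"
    and bound: "\<And>x v. x \<in> U \<Longrightarrow> norm v \<le> 2 * norm (A x v)"
  shows "(\<And>v. Ck_on k U (\<lambda>x. A x v)) \<Longrightarrow> Ck_on k U (\<lambda>x. B x v)"
proof -
  have linB: "linear (B x)" if "x \<in> U" for x
  proof
    fix v w c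
    have "B x (A x (B x v + B x w)) = B x (v + w)" "B x (A x (c *\<^sub>R B x v)) = B x (c *\<^sub>R v)"
      using that A[OF that] AB by (auto simp: linear_add linear_scale)
    then show "B x (v + w) = B x v + B x w" "B x (c *\<^sub>R v) = c *\<^sub>R B x v" using BA that by auto
  qed
  have diff: "B y v - B x v = - B y (A y (B x v) - A x (B x v))" if "x \<in> U" "y \<in> U" for x y v
    using that by (simp add: linear_diff[OF linB] AB BA)
  have Bb: "norm (B x v) \<le> 2 * norm v" if "x \<in> U" for x v
    using bound[OF that, of "B x v"] AB that by simp
  have cont: "isCont (\<lambda>x. B x v) x" if x: "x \<in> U" and cA: "\<And>w. continuous_on U (\<lambda>x. A x w)" for x v
  proof -
    have "((\<lambda>y. A y (B x v)) \<longlongrightarrow> A x (B x v)) (at x)"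
      using cA[of "B x v"] x assms(1) by (simp add: continuous_on_eq_continuous_at isCont_def)
    then have 1: "((\<lambda>y. 2 * norm (A y (B x v) - A x (B x v))) \<longlongrightarrow> 0) (at x)"
      by (intro tendsto_mult_right_zero tendsto_norm_zero) (simp add: LIM_zero)
    have "((\<lambda>y. B y v - B x v) \<longlongrightarrow> 0) (at x)"
    proof (rule Lim_null_comparison[OF _ 1])
      show "\<forall>\<^sub>F y in at x. norm (B y v - B x v) \<le> 2 * norm (A y (B x v) - A x (B x v))"
        using eventually_at_in_open'[OF assms(1) x]
      proof eventually_elim
        case (elim y)
        then show ?case using Bb[of y] diff[OF x, of y v] by simp
      qed
    qed
    then show ?thesis by (simp add: isCont_def LIM_zero_iff)
  qed
  show "(\<And>v. Ck_on k U (\<lambda>x. A x v)) \<Longrightarrow> Ck_on k U (\<lambda>x. B x v)"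
  proof (induction k arbitrary: v)
    case 0
    then show ?case using cont by (auto intro!: continuous_at_imp_continuous_on)
  next
    case (Suc k)
    note lower = Suc.prems[THEN Ck_on_SucD]
    have IH: "Ck_on k U (\<lambda>x. B x v)" for v using Suc.IH lower by blast
    have cA: "continuous_on U (\<lambda>x. A x w)" for w
      using Suc.prems[of w] by (auto intro!: continuous_at_imp_continuous_on differentiable_imp_continuous_within)
    define A' where "A' w x = frechet_derivative (\<lambda>x. A x w) (at x)" for w x
    have A': "((\<lambda>x. A x w) has_derivative A' w x) (at x)" if "x \<in> U" for w x
      using Suc.prems[of w] that by (simp add: A'_def frechet_derivative_works)
    have A'lin: "A' w x h = (\<Sum>c\<in>Basis. (w \<bullet> c) *\<^sub>R A' c x h)" if "x \<in> U" for w x h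
    proof -
      have "((\<lambda>x. \<Sum>c\<in>Basis. (w \<bullet> c) *\<^sub>R A x c) has_derivative (\<lambda>h. \<Sum>c\<in>Basis. (w \<bullet> c) *\<^sub>R A' c x h)) (at x)"
        by (intro has_derivative_sum has_derivative_scaleR_right A'[OF that])
      then have "((\<lambda>x. A x w) has_derivative (\<lambda>h. \<Sum>c\<in>Basis. (w \<bullet> c) *\<^sub>R A' c x h)) (at x)"
        by (rule has_derivative_transform_within_open[OF _ assms(1) that])
          (rule linear_expand_Basis[OF A, symmetric])
      from has_derivative_unique[OF A'[OF that, of w] this] show ?thesis by (rule fun_cong)
    qed
    define B' where "B' v x h = - B x (A' (B x v) x h)" for v x h
    have B': "((\<lambda>x. B x v) has_derivative B' v x) (at x)" if x: "x \<in> U" for v x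
    proof -
      define w where "w = B x v"
      have "((\<lambda>y. \<Sum>b\<in>Basis. ((A y w - A x w) \<bullet> b) *\<^sub>R B y b) has_derivative
          (\<lambda>h. \<Sum>b\<in>Basis. (A' w x h \<bullet> b) *\<^sub>R B x b)) (at x)"
      proof (intro has_derivative_sum has_derivative_scaleR_at_zero cont[OF x cA])
        have "((\<lambda>y. A y w - A x w) has_derivative (\<lambda>h. A' w x h - 0)) (at x)"
          by (intro has_derivative_diff has_derivative_const A'[OF x])
        then show "((\<lambda>y. (A y w - A x w) \<bullet> b) has_derivative (\<lambda>h. A' w x h \<bullet> b)) (at x)" for b
          using has_derivative_inner_left by fastforce
      qed simp
      then have "((\<lambda>y. B x v - (\<Sum>b\<in>Basis. ((A y w - A x w) \<bullet> b) *\<^sub>R B y b)) has_derivative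
          (\<lambda>h. 0 - (\<Sum>b\<in>Basis. (A' w x h \<bullet> b) *\<^sub>R B x b))) (at x)"
        by (intro has_derivative_diff has_derivative_const)
      also have "(\<lambda>h. 0 - (\<Sum>b\<in>Basis. (A' w x h \<bullet> b) *\<^sub>R B x b)) = B' v x"
        by (simp add: B'_def w_def fun_eq_iff linear_expand_Basis[OF linB[OF x], symmetric])
      finally show ?thesis
      proof (rule has_derivative_transform_within_open[OF _ assms(1) x])
        fix y assume y: "y \<in> U"
        show "B x v - (\<Sum>b\<in>Basis. ((A y w - A x w) \<bullet> b) *\<^sub>R B y b) = B y v"
          unfolding w_def linear_expand_Basis[OF linB[OF y], symmetric]
          using diff[OF x y, of v] by (metis add_uminus_conv_diff diff_add_cancel add.commute)
      qed
    qed
    show ?case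
    proof (rule Ck_on_SucI[OF assms(1) B'])
      fix h
      have A'C: "Ck_on k U (\<lambda>x. A' c x h)" for c
        using Suc.prems[of c] by (simp add: A'_def)
      have inner: "Ck_on k U (\<lambda>x. g x \<bullet> c)" if "Ck_on k U g" for g :: "'a \<Rightarrow> 'b" and c
        by (rule Ck_on_bounded_linear[OF assms(1) bounded_linear_inner_left that])
      have S: "Ck_on k U (\<lambda>x. \<Sum>c\<in>Basis. (B x v \<bullet> c) *\<^sub>R A' c x h)"
        by (intro Ck_on_sum Ck_on_scaleR assms(1) inner IH A'C)
      have S': "Ck_on k U (\<lambda>x. A' (B x v) x h)"
        by (rule Ck_on_cong[OF assms(1) _ S]) (rule A'lin[symmetric])
      have "Ck_on k U (\<lambda>x. - (\<Sum>b\<in>Basis. (A' (B x v) x h \<bullet> b) *\<^sub>R B x b))"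
        by (intro Ck_on_bounded_linear[OF assms(1) bounded_linear_minus[OF bounded_linear_ident]]
            Ck_on_sum Ck_on_scaleR assms(1) inner S' IH)
      then show "Ck_on k U (\<lambda>x. B' v x h)"
        by (rule Ck_on_cong[OF assms(1), rotated])
          (simp add: B'_def linear_expand_Basis[OF linB, symmetric])
    qed
  qed
qed

text \<open>The inverse function theorem gives a differentiable local inverse \<open>H\<close>; by
\<open>DH(y) = (DF(H y))\<inverse>\<close> and smoothness of inversion, \<open>H\<close> has one
derivative more than it is already known to have, hence all of them. That the differential at
\<open>y0\<close> is the identity provides the bound on the inverses which the previous lemma asks
for.\<close>

lemma smooth_inverse_function:
  fixes F :: "'a::euclidean_space \<Rightarrow> 'a"
  assumes O: "open O1" "y0 \<in> O1" and F: "\<And>k. Ck_on k O1 F"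
    and id: "\<And>v. frechet_derivative F (at y0) v = v"
  obtains O' Q H where "open O'" "O' \<subseteq> O1" "y0 \<in> O'" "open Q" "homeomorphism O' Q F H"
    "\<And>k. Ck_on k Q H"
proof -
  define DF where "DF x = frechet_derivative F (at x)" for x
  have F1: "\<forall>x\<in>O1. F differentiable at x" "\<And>v k. Ck_on k O1 (\<lambda>x. DF x v)"
    using F[of "Suc _"] by (auto simp: DF_def)
  have DF: "(F has_derivative DF x) (at x)" if "x \<in> O1" for x
    using F1 that by (simp add: DF_def frechet_derivative_works)
  define f' where "f' x = Blinfun (DF x)" for x
  have f': "blinfun_apply (f' x) = DF x" if "x \<in> O1" for x
    unfolding f'_def by (rule bounded_linear_Blinfun_apply) (rule has_derivative_bounded_linear[OF DF[OF that]])
  have cont: "continuous_on O1 f'"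
  proof (rule continuous_on_blinfun_componentwise)
    fix i :: 'a
    have "continuous_on O1 (\<lambda>x. DF x i)" using F1(2)[of 0 i] by simp
    then show "continuous_on O1 (\<lambda>x. blinfun_apply (f' x) i)" by (simp add: f' cong: continuous_on_cong)
  qed
  have f0: "f' y0 = id_blinfun"
    by (rule blinfun_eqI) (use f'[OF O(2)] id in \<open>simp add: DF_def\<close>)
  \<comment> \<open>Close to \<open>y0\<close> the differential differs from the identity by less
  than \<open>1/2\<close>, so the inverses have norm at most \<open>2\<close>.\<close>
  define U where "U = {x \<in> O1. dist (f' x) id_blinfun < 1/2}"
  have U: "open U" "y0 \<in> U" "U \<subseteq> O1"
  proof -
    have "U = O1 \<inter> f' -` (ball id_blinfun (1/2))" by (auto simp: U_def dist_commute)
    then show "open U" using continuous_open_preimage[OF cont O(1)] by simp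
  qed (use f0 O in \<open>auto simp: U_def\<close>)
  obtain U' V g g' where *: "open U'" "U' \<subseteq> U" "y0 \<in> U'" "open V" "F y0 \<in> V" "homeomorphism U' V F g"
    "\<And>y. y \<in> V \<Longrightarrow> (g has_derivative (g' y)) (at y)"
    "\<And>y. y \<in> V \<Longrightarrow> g' y = inv (blinfun_apply (f' (g y)))"
    "\<And>y. y \<in> V \<Longrightarrow> bij (blinfun_apply (f' (g y)))"
  proof (rule inverse_function_theorem[of U F f' y0 id_blinfun])
    show "(F has_derivative blinfun_apply (f' x)) (at x)" if "x \<in> U" for x
      using that U DF f' by auto
    show "continuous_on U f'" using cont U by (auto intro: continuous_on_subset)
    show "id_blinfun o\<^sub>L f' y0 = id_blinfun" by (simp add: f0 blinfun_eqI)
  qed (use U in auto)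
  have gU: "g y \<in> U'" if "y \<in> V" for y using *(6) that by (auto simp: homeomorphism_def)
  have g'eq: "g' y = inv (DF (g y))" "bij (DF (g y))" if "y \<in> V" for y
    using *(8,9)[OF that] f'[of "g y"] gU[OF that] *(2) U(3) by (auto simp: subset_iff)
  have bound: "norm v \<le> 2 * norm (DF x v)" if "x \<in> U" for x v
  proof -
    have "norm (blinfun_apply (f' x - id_blinfun) v) \<le> norm (f' x - id_blinfun) * norm v"
      by (rule norm_blinfun)
    also have "\<dots> \<le> 1/2 * norm v"
      using that by (intro mult_right_mono) (auto simp: U_def dist_norm)
    finally have "norm (DF x v - v) \<le> 1/2 * norm v"
      using f' U that by (auto simp: blinfun.diff_left)
    then show ?thesis using norm_triangle_sub[of v "DF x v"] norm_minus_commute[of v "DF x v"] by linarith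
  qed
  have smooth: "Ck_on k V g" for k
  proof (induction k)
    case 0
    then show ?case using *(6) by (simp add: homeomorphism_def)
  next
    case (Suc k)
    have DFg: "Ck_on k V (\<lambda>y. DF (g y) v)" for v
      by (rule Ck_on_compose[OF *(4) O(1) Suc F1(2)]) (use gU *(2) U in auto)
    have "Ck_on k V (\<lambda>y. g' y v)" for v
    proof (rule Ck_on_inverse_family[OF *(4), where A="\<lambda>y. DF (g y)"])
      show "linear (DF (g y))" if "y \<in> V" for y
        using gU[OF that] *(2) U DF has_derivative_linear by blast
      show "norm v \<le> 2 * norm (DF (g y) v)" if "y \<in> V" for y v
        using gU[OF that] *(2) bound by auto
    qed (use g'eq DFg in \<open>auto simp: bij_is_inj bij_is_surj surj_f_inv_f\<close>)
    then show ?case using *(7) by (intro Ck_on_SucI[OF *(4)])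
  qed
  show thesis by (rule that[OF *(1) _ *(3,4,6) smooth]) (use *(2) U in auto)
qed

section \<open>Derivatives along the directions of a subspace\<close>

text \<open>The image of a chart lies in a subspace \<open>V\<close>, possibly on one side of a
hyperplane, so a derivative within it is determined neither on the whole space nor by full line
segments. The predicate asks that for every direction in \<open>V\<close> one of the two opposite
rays issuing from \<open>x\<close> starts inside \<open>S\<close>. By linearity this suffices to
determine derivatives on \<open>V\<close>.\<close>

definition tangential :: "'a::euclidean_space set \<Rightarrow> 'a \<Rightarrow> 'a set \<Rightarrow> bool" where
  "tangential S x V \<longleftrightarrow> x \<in> S \<and> (\<forall>v\<in>V. \<exists>c::real. c \<noteq> 0 \<and> (\<forall>\<^sub>F \<tau> in at_right 0. x + (\<tau> * c) *\<^sub>R v \<in> S))"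

lemma tangential_mono: "tangential S x V \<Longrightarrow> S \<subseteq> S' \<Longrightarrow> V' \<subseteq> V \<Longrightarrow> tangential S' x V'"
  unfolding tangential_def by (smt (verit) eventually_mono subset_iff)

lemma ray_eventually_in_open:
  fixes x v :: "'a::real_normed_vector"
  assumes "open N" "x \<in> N"
  shows "\<forall>\<^sub>F \<tau> in at_right 0. x + (\<tau> * c) *\<^sub>R v \<in> N"
proof -
  have "((\<lambda>\<tau>. x + (\<tau> * c) *\<^sub>R v) \<longlongrightarrow> x + (0 * c) *\<^sub>R v) (at_right 0)"
    by (intro tendsto_intros)
  then show ?thesis using topological_tendstoD[of _ x _ N] assms by simp
qed

lemma tangential_Int_open:
  assumes "tangential S x V" "open N" "x \<in> N"
  shows "tangential (S \<inter> N) x V"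
  unfolding tangential_def
proof (intro conjI ballI)
  fix v assume "v \<in> V"
  then obtain c where "c \<noteq> 0" "\<forall>\<^sub>F \<tau> in at_right 0. x + (\<tau> * c) *\<^sub>R v \<in> S"
    using assms(1) unfolding tangential_def by blast
  with ray_eventually_in_open[OF assms(2,3), of c v]
  show "\<exists>c. c \<noteq> 0 \<and> (\<forall>\<^sub>F \<tau> in at_right 0. x + (\<tau> * c) *\<^sub>R v \<in> S \<inter> N)"
    by (intro exI[of _ c]) (auto elim: eventually_elim2)
qed (use assms in \<open>auto simp: tangential_def\<close>)

lemma tangential_half_space:
  assumes V: "subspace V" and x: "x \<in> half_space V \<nu>" and N: "open N" "x \<in> N"
  shows "tangential (half_space V \<nu> \<inter> N) x V"
proof -
  have "tangential (half_space V \<nu>) x V"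
    unfolding tangential_def
  proof (intro conjI ballI x)
    fix v assume v: "v \<in> V"
    \<comment> \<open>The sign for which \<open>c *\<^sub>R v\<close> points into the half
    space.\<close>
    define c :: real where "c = (if 0 \<le> v \<bullet> \<nu> then 1 else -1)"
    have c: "c \<noteq> 0" "0 \<le> c * (v \<bullet> \<nu>)" by (auto simp: c_def)
    have "x + (\<tau> * c) *\<^sub>R v \<in> half_space V \<nu>" if "\<tau> > 0" for \<tau>
    proof -
      have "0 \<le> \<tau> * (c * (v \<bullet> \<nu>))" using that c by simp
      then show ?thesis using x v V
        by (auto simp: half_space_def inner_add_left mult.assoc subspace_add subspace_scale)
    qed
    then show "\<exists>c. c \<noteq> 0 \<and> (\<forall>\<^sub>F \<tau> in at_right 0. x + (\<tau> * c) *\<^sub>R v \<in> half_space V \<nu>)"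
      using c by (intro exI[of _ c]) (auto simp: eventually_at_right_less eventually_mono[OF eventually_at_right_less])
  qed
  then show ?thesis using N by (rule tangential_Int_open)
qed

lemma tangential_span:
  assumes "tangential S x V" "S \<subseteq> V" "subspace V"
  shows "span S = V"
proof
  show "span S \<subseteq> V" using assms by (simp add: span_minimal)
  show "V \<subseteq> span S"
  proof
    fix v assume "v \<in> V"
    then obtain c where c: "c \<noteq> 0" "\<forall>\<^sub>F \<tau> in at_right 0. x + (\<tau> * c) *\<^sub>R v \<in> S"
      using assms(1) unfolding tangential_def by blast
    from eventually_conj[OF c(2) eventually_at_right_less]
    obtain \<tau> where \<tau>: "x + (\<tau> * c) *\<^sub>R v \<in> S" "0 < \<tau>"
      using eventually_happens[of _ "at_right (0::real)"] by auto
    have "(x + (\<tau> * c) *\<^sub>R v) - x \<in> span S"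
      using \<tau> assms(1) by (intro span_diff span_base) (auto simp: tangential_def)
    then have 1: "(\<tau> * c) *\<^sub>R v \<in> span S" by simp
    have "\<tau> * c \<noteq> 0" using c \<tau> by simp
    then have "v = inverse (\<tau> * c) *\<^sub>R ((\<tau> * c) *\<^sub>R v)" by (metis scaleR_scaleR left_inverse scaleR_one)
    with span_scale[OF 1] show "v \<in> span S" by metis
  qed
qed

text \<open>Along a ray that starts inside \<open>S\<close> the difference quotient of a constant
function is zero and converges to a nonzero multiple of \<open>f' v\<close>. Uniqueness of
derivatives, the chain rule and invariance of subspaces are consequences.\<close>

lemma derivative_of_constant_tangential:
  fixes f :: "'a::euclidean_space \<Rightarrow> 'b::real_normed_vector"
  assumes f: "(f has_derivative f') (at x within S)" and k: "\<And>y. y \<in> S \<Longrightarrow> f y = k"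
    and tan: "tangential S x V" and v: "v \<in> V"
  shows "f' v = 0"
proof -
  obtain c where c: "c \<noteq> 0" "\<forall>\<^sub>F \<tau> in at_right 0. x + (\<tau> * c) *\<^sub>R v \<in> S"
    using tan v unfolding tangential_def by blast
  have lin: "linear f'" using f by (rule has_derivative_linear)
  define A where "A = {\<tau>. 0 < \<tau> \<and> x + (\<tau> * c) *\<^sub>R v \<in> S}"
  have nb: "at 0 within A \<noteq> bot"
  proof
    assume "at 0 within A = bot"
    then have "\<forall>\<^sub>F \<tau> in at 0 within A. False" by simp
    then have "\<forall>\<^sub>F \<tau> in at_right 0. \<tau> \<in> A \<longrightarrow> False"
      unfolding eventually_at_filter by eventually_elim auto
    with c(2) eventually_at_right_less[of "0::real"] have "\<forall>\<^sub>F \<tau> in at_right (0::real). False"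
      by eventually_elim (auto simp: A_def)
    then show False by simp
  qed
  have ray: "((\<lambda>\<tau>. x + (\<tau> * c) *\<^sub>R v) has_derivative (\<lambda>\<tau>. (\<tau> * c) *\<^sub>R v)) (at 0 within A)"
    by (auto intro!: derivative_eq_intros)
  have "(f has_derivative f') (at (x + (0 * c) *\<^sub>R v) within (\<lambda>\<tau>. x + (\<tau> * c) *\<^sub>R v) ` A)"
    by (rule has_derivative_subset[of _ _ _ S]) (use f in \<open>auto simp: A_def\<close>)
  from has_derivative_in_compose[OF ray this]
  have "((\<lambda>\<tau>. (1 / norm (\<tau> - 0)) *\<^sub>R (f (x + (\<tau> * c) *\<^sub>R v) - (f (x + (0 * c) *\<^sub>R v) + f' (((\<tau> - 0) * c) *\<^sub>R v)))) \<longlongrightarrow> 0)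
      (at 0 within A)"
    unfolding has_derivative_within by blast
  from tendsto_norm_zero[OF this] have "((\<lambda>\<tau>. \<bar>c\<bar> * norm (f' v)) \<longlongrightarrow> 0) (at 0 within A)"
  proof (rule Lim_transform_eventually)
    have "f x = k" using k tan by (auto simp: tangential_def)
    then show "\<forall>\<^sub>F \<tau> in at 0 within A. norm ((1 / norm (\<tau> - 0)) *\<^sub>R (f (x + (\<tau> * c) *\<^sub>R v) - (f (x + (0 * c) *\<^sub>R v) + f' (((\<tau> - 0) * c) *\<^sub>R v))))
      = \<bar>c\<bar> * norm (f' v)"
      unfolding eventually_at_filter
      using k by (intro always_eventually) (auto simp: A_def linear_scale[OF lin] abs_mult)
  qed
  then have "\<bar>c\<bar> * norm (f' v) = 0" using tendsto_unique[OF nb tendsto_const] by blast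
  then show ?thesis using c by simp
qed

lemma derivative_unique_tangential:
  fixes f :: "'a::euclidean_space \<Rightarrow> 'b::real_normed_vector"
  assumes "(f has_derivative f') (at x within S)" "(g has_derivative g') (at x within S)"
    and eq: "\<And>y. y \<in> S \<Longrightarrow> f y = g y" and tan: "tangential S x V" and v: "v \<in> V"
  shows "f' v = g' v"
proof -
  have "((\<lambda>y. f y - g y) has_derivative (\<lambda>v. f' v - g' v)) (at x within S)"
    by (intro has_derivative_diff assms)
  from derivative_of_constant_tangential[OF this _ tan v, of 0] eq show ?thesis by simp
qed

text \<open>Apply the previous lemmas to the inner product of \<open>f\<close> with the component
of \<open>f' v\<close> that is orthogonal to \<open>W\<close>: this function vanishes on
\<open>S\<close>.\<close>

lemma derivative_into_subspace:
  fixes f :: "'a::euclidean_space \<Rightarrow> 'b::euclidean_space"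
  assumes f: "(f has_derivative f') (at x within S)" and W: "subspace W" "\<And>y. y \<in> S \<Longrightarrow> f y \<in> W"
    and tan: "tangential S x V" and v: "v \<in> V"
  shows "f' v \<in> W"
proof -
  obtain y z where yz: "y \<in> span W" "\<And>w. w \<in> span W \<Longrightarrow> orthogonal z w" "f' v = y + z"
    using orthogonal_subspace_decomp_exists[of W "f' v"] by blast
  have "((\<lambda>y. f y \<bullet> z) has_derivative (\<lambda>v. f' v \<bullet> z)) (at x within S)"
    by (rule has_derivative_inner_left[OF f])
  moreover have "f y \<bullet> z = 0" if "y \<in> S" for y
    using yz(2)[OF span_base[OF W(2)[OF that]]] by (simp add: orthogonal_def inner_commute)
  ultimately have "f' v \<bullet> z = 0"
    by (rule derivative_of_constant_tangential[OF _ _ tan v])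
  moreover have "y \<bullet> z = 0" using yz(1,2) by (auto simp: orthogonal_def inner_commute)
  ultimately have "z = 0" using yz(3) by (simp add: inner_add_left)
  then show ?thesis using yz W by (simp add: span_eq_iff[THEN iffD2])
qed

lemma derivative_chain_tangential:
  fixes h :: "'a::euclidean_space \<Rightarrow> 'c::real_normed_vector"
  assumes f: "(f has_derivative f') (at x within S)" and g: "(g has_derivative g') (at (f x) within R)"
    and sub: "f ` S \<subseteq> R" and h: "(h has_derivative h') (at x within S)"
    and eq: "\<And>y. y \<in> S \<Longrightarrow> h y = g (f y)" and tan: "tangential S x V" and v: "v \<in> V"
  shows "h' v = g' (f' v)"
proof -
  have "((\<lambda>y. g (f y)) has_derivative (\<lambda>v. g' (f' v))) (at x within S)"
    by (rule has_derivative_in_compose[OF f has_derivative_subset[OF g sub]])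
  from derivative_unique_tangential[OF h this eq tan v] show ?thesis .
qed

text \<open>The translation by \<open>a\<close> does not change derivatives; \<open>a = 0\<close>
is the case of a left inverse.\<close>

lemma derivative_left_inverse_tangential:
  assumes "(f has_derivative f') (at x within S)" "(g has_derivative g') (at (f x) within R)"
    "f ` S \<subseteq> R" "\<And>y. y \<in> S \<Longrightarrow> g (f y) = y + a" "tangential S x V" "v \<in> V"
  shows "g' (f' v) = v"
proof -
  have "((\<lambda>y. y + a) has_derivative (\<lambda>v. v + 0)) (at x within S)"
    by (rule has_derivative_add[OF has_derivative_ident has_derivative_const])
  from derivative_chain_tangential[OF assms(1-3) this _ assms(5,6)] assms(4) show ?thesis by simp
qed

section \<open>Smooth maps on arbitrary sets and charts\<close>

lemma smooth_on_extension:
  assumes "smooth_on S f" "x \<in> S"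
  obtains U g where "open U" "x \<in> U" "\<And>k. Ck_on k U g" "\<And>y. y \<in> S \<inter> U \<Longrightarrow> f y = g y"
  using assms unfolding smooth_on_def by metis

lemma smooth_on_has_derivative:
  assumes "smooth_on S f" "x \<in> S"
  shows "(f has_derivative frechet_derivative f (at x within S)) (at x within S)"
proof -
  obtain U g where U: "open U" "x \<in> U" "\<And>k. Ck_on k U g" "\<And>y. y \<in> S \<inter> U \<Longrightarrow> f y = g y"
    using smooth_on_extension[OF assms] by blast
  have "(g has_derivative frechet_derivative g (at x)) (at x within S)"
    using U(2) U(3)[of 1] by (auto simp: frechet_derivative_works intro: has_derivative_at_withinI)
  moreover have "\<forall>\<^sub>F y in at x within S. g y = f y"
    unfolding eventually_at_topological using U(1,2,4) by (intro exI[of _ U]) auto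
  ultimately have "(f has_derivative frechet_derivative g (at x)) (at x within S)"
    using U assms by (auto intro: has_derivative_transform_eventually)
  then show ?thesis by (auto simp: frechet_derivative_works[symmetric] differentiable_def)
qed

lemma smooth_on_cong:
  assumes f: "smooth_on S f" and R: "R \<subseteq> S" "\<And>y. y \<in> R \<Longrightarrow> f y = g y"
  shows "smooth_on R g"
  unfolding smooth_on_def
proof
  fix x assume "x \<in> R"
  then have "x \<in> S" using R by auto
  then obtain U h where "open U" "x \<in> U" "\<forall>k. Ck_on k U h" "\<forall>y\<in>S \<inter> U. f y = h y"
    using f unfolding smooth_on_def by blast
  then show "\<exists>U h. open U \<and> x \<in> U \<and> (\<forall>k. Ck_on k U h) \<and> (\<forall>y\<in>R \<inter> U. g y = h y)"
    using R(1) R(2)[symmetric] by (intro exI[of _ U] exI[of _ h]) auto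
qed

lemma smooth_on_subset: "smooth_on S f \<Longrightarrow> R \<subseteq> S \<Longrightarrow> smooth_on R f"
  using smooth_on_cong by blast

lemma smooth_onI_Ck: "open U \<Longrightarrow> (\<And>k. Ck_on k U f) \<Longrightarrow> S \<subseteq> U \<Longrightarrow> smooth_on S f"
  unfolding smooth_on_def by (intro ballI exI[of _ U] exI[of _ f]) auto

lemma smooth_on_compose:
  assumes f: "smooth_on S f" and g: "smooth_on R g" and sub: "f ` S \<subseteq> R"
  shows "smooth_on S (\<lambda>x. g (f x))"
  unfolding smooth_on_def
proof
  fix x assume x: "x \<in> S"
  obtain U f1 where U: "open U" "x \<in> U" "\<And>k. Ck_on k U f1" "\<And>y. y \<in> S \<inter> U \<Longrightarrow> f y = f1 y"
    using smooth_on_extension[OF f x] by blast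
  have "f x \<in> R" using sub x by auto
  then obtain W g1 where W: "open W" "f x \<in> W" "\<And>k. Ck_on k W g1" "\<And>y. y \<in> R \<inter> W \<Longrightarrow> g y = g1 y"
    using smooth_on_extension[OF g] by blast
  define N where "N = U \<inter> f1 -` W"
  have "continuous_on U f1" using U(3)[of 0] by simp
  then have N: "open N" unfolding N_def using U(1) W(1) by (rule continuous_open_preimage)
  show "\<exists>N h. open N \<and> x \<in> N \<and> (\<forall>k. Ck_on k N h) \<and> (\<forall>y\<in>S \<inter> N. g (f y) = h y)"
  proof (intro exI conjI allI ballI)
    show "Ck_on k N (\<lambda>y. g1 (f1 y))" for k
      by (rule Ck_on_compose[OF N W(1) Ck_on_subset[OF U(3)] W(3)]) (auto simp: N_def)
    show "x \<in> N" using x U W by (auto simp: N_def)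
    show "g (f y) = g1 (f1 y)" if "y \<in> S \<inter> N" for y
    proof -
      have "f y = f1 y" using that U(4) by (auto simp: N_def)
      moreover have "f y \<in> R" using that sub by auto
      ultimately show ?thesis using that W(4) by (auto simp: N_def)
    qed
  qed (rule N)
qed

lemma chart_openin: "chart T n U \<phi> \<Longrightarrow> openin T U"
  and chart_subset: "chart T n U \<phi> \<Longrightarrow> U \<subseteq> topspace T"
  by (auto simp: chart_def openin_subset)

lemma chart_inj_on:
  assumes "chart T n U \<phi>"
  shows "inj_on \<phi> U"
proof -
  have "topspace (subtopology T U) = U" using chart_subset[OF assms] by auto
  then show ?thesis
    using assms unfolding chart_def homeomorphic_map_def by metis
qed

lemma chart_image_openin:
  assumes "chart T n U \<phi>" "openin T Q" "Q \<subseteq> U"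
  obtains N where "open N" "\<phi> ` Q = \<phi> ` U \<inter> N"
proof -
  have "openin (subtopology T U) Q" using assms by (simp add: openin_subtopology Int_absorb2) (metis assms(2) inf.absorb1)
  moreover have "homeomorphic_map (subtopology T U) (top_of_set (\<phi> ` U)) \<phi>"
    using assms by (simp add: chart_def)
  ultimately have "openin (top_of_set (\<phi> ` U)) (\<phi> ` Q)"
    using homeomorphic_map_openness_eq by blast
  then show thesis using that by (auto simp: openin_open)
qed

lemma chart_continuous:
  assumes "chart T n U \<phi>"
  shows "continuous_map (subtopology T U) euclidean \<phi>"
  using assms homeomorphic_imp_continuous_map[of "subtopology T U" "top_of_set (\<phi> ` U)" \<phi>]
  by (auto simp: chart_def continuous_map_in_subtopology)

lemma chart_inverse_continuous:
  assumes "chart T n U \<phi>"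
  shows "continuous_map (top_of_set (\<phi> ` U)) (subtopology T U) (inv_into U \<phi>)"
proof -
  have "topspace (subtopology T U) = U" using chart_subset[OF assms] by auto
  moreover obtain g where g: "homeomorphic_maps (subtopology T U) (top_of_set (\<phi> ` U)) \<phi> g"
    using assms by (auto simp: chart_def homeomorphic_map_maps)
  ultimately have "g y = inv_into U \<phi> y" if "y \<in> \<phi> ` U" for y
    using that chart_inj_on[OF assms] by (auto simp: homeomorphic_maps_def)
  then show ?thesis using g
    by (auto simp: homeomorphic_maps_def intro: continuous_map_eq)
qed

text \<open>For each direction in \<open>V\<close> it or its opposite does not lead towards the
boundary hyperplane, so that the ray from any point of the half space stays in the half space. The
second part identifies the tangent space in the chart with the span of its image.\<close>

lemma open_in_half_space_tangential:
  assumes "subspace V" "openin (top_of_set (half_space V \<nu>)) S" "x \<in> S"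
  shows "tangential S x V" "span S = V"
proof -
  obtain N where N: "open N" "S = half_space V \<nu> \<inter> N" using assms(2) by (auto simp: openin_open)
  then show "tangential S x V" using tangential_half_space[OF assms(1)] assms(3) by auto
  then show "span S = V" by (rule tangential_span) (use N assms in \<open>auto simp: half_space_def\<close>)
qed

lemma chart_half_space:
  assumes "chart T n U \<phi>" "p \<in> U"
  obtains \<nu> where "\<nu> \<in> span (\<phi> ` U)" "openin (top_of_set (half_space (span (\<phi> ` U)) \<nu>)) (\<phi> ` U)"
    "dim (span (\<phi> ` U)) = n"
proof -
  obtain V \<nu> where V: "subspace V" "dim V = n" "\<nu> \<in> V" "openin (top_of_set (half_space V \<nu>)) (\<phi> ` U)"
    using assms unfolding chart_def by blast
  with open_in_half_space_tangential(2)[OF V(1,4)] assms have "span (\<phi> ` U) = V" by blast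
  with V that show thesis by metis
qed

lemma chart_tangential:
  assumes "chart T n U \<phi>" "openin T Q" "Q \<subseteq> U" "p \<in> Q"
  shows "tangential (\<phi> ` Q) (\<phi> p) (span (\<phi> ` U))"
proof -
  have pU: "p \<in> U" using assms by auto
  obtain \<nu> where "openin (top_of_set (half_space (span (\<phi> ` U)) \<nu>)) (\<phi> ` U)"
    using chart_half_space[OF assms(1) pU] by metis
  then have 1: "tangential (\<phi> ` U) (\<phi> p) (span (\<phi> ` U))"
    using open_in_half_space_tangential(1) subspace_span pU by blast
  obtain N where N: "open N" "\<phi> ` Q = \<phi> ` U \<inter> N" using chart_image_openin[OF assms(1-3)] .
  moreover have "\<phi> p \<in> N" using N(2) assms(4) by auto
  ultimately show ?thesis using tangential_Int_open[OF 1] by simp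
qed

lemma chart_dim: "chart T n U \<phi> \<Longrightarrow> p \<in> U \<Longrightarrow> dim (span (\<phi> ` U)) = n"
  by (rule chart_half_space)

lemma chart_openin_preimage:
  assumes "chart T n U \<phi>" "open N"
  shows "openin T {q \<in> U. \<phi> q \<in> N}"
proof -
  have "openin (subtopology T U) {q \<in> topspace (subtopology T U). \<phi> q \<in> N}"
    using openin_continuous_map_preimage[OF chart_continuous[OF assms(1)]] assms(2) by simp
  moreover have "topspace (subtopology T U) = U" using chart_subset[OF assms(1)] by auto
  ultimately show ?thesis using chart_openin[OF assms(1)] openin_trans_full by fastforce
qed

text \<open>This is the part of \<^const>\<open>smooth_manifold\<close> that computations in
charts use. It also holds for the manifold with a single chart that appears in the definition of
\<^const>\<open>submanifold\<close>.\<close>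

definition smooth_atlas :: "('a, 'e::euclidean_space) manifold \<Rightarrow> bool" where
  "smooth_atlas M \<longleftrightarrow> (\<forall>(U, \<phi>)\<in>atlas M. chart (mtop M) (mdim M) U \<phi>) \<and>
     (\<forall>(U, \<phi>)\<in>atlas M. \<forall>(W, \<psi>)\<in>atlas M. smooth_on (\<phi> ` (U \<inter> W)) (\<psi> \<circ> inv_into U \<phi>))"

lemma smooth_manifold_atlas: "smooth_manifold M \<Longrightarrow> smooth_atlas M"
  by (simp add: smooth_manifold_def smooth_atlas_def)

lemma smooth_atlas_chart: "smooth_atlas M \<Longrightarrow> (U, \<phi>) \<in> atlas M \<Longrightarrow> chart (mtop M) (mdim M) U \<phi>"
  and smooth_atlas_transition: "smooth_atlas M \<Longrightarrow> (U, \<phi>) \<in> atlas M \<Longrightarrow> (W, \<psi>) \<in> atlas M \<Longrightarrow>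
    smooth_on (\<phi> ` (U \<inter> W)) (\<psi> \<circ> inv_into U \<phi>)"
  by (auto simp: smooth_atlas_def)

lemma smooth_map_openin:
  assumes "smooth_map M N f" "openin (mtop M) U" "openin (mtop N) W"
  shows "openin (mtop M) {x \<in> U. f x \<in> W}"
proof -
  have "openin (mtop M) {x \<in> points M. f x \<in> W}"
    using assms openin_continuous_map_preimage by (fastforce simp: smooth_map_on_def)
  moreover have "{x \<in> U. f x \<in> W} = U \<inter> {x \<in> points M. f x \<in> W}"
    using assms(2) openin_subset by blast
  ultimately show ?thesis using assms(2) by auto
qed

lemma smooth_map_smooth_on:
  assumes "smooth_map M N f" "smooth_atlas M" "(U, \<phi>) \<in> atlas M" "(W, \<psi>) \<in> atlas N"
  shows "smooth_on (\<phi> ` {x \<in> U. f x \<in> W}) (\<psi> \<circ> f \<circ> inv_into U \<phi>)"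
proof -
  have "U \<subseteq> points M" using smooth_atlas_chart[OF assms(2,3)] chart_subset by blast
  then have "U \<inter> points M = U" by auto
  moreover have "smooth_on (\<phi> ` {x \<in> U \<inter> points M. f x \<in> W}) (\<psi> \<circ> f \<circ> inv_into U \<phi>)"
    using assms unfolding smooth_map_on_def by auto
  ultimately show ?thesis by simp
qed

lemma chart_at_in:
  assumes "(U, \<phi>) \<in> atlas M" "p \<in> U"
  shows "chart_at M p \<in> atlas M" "p \<in> fst (chart_at M p)"
  using someI[of "\<lambda>c. c \<in> atlas M \<and> p \<in> fst c" "(U, \<phi>)"] assms by (auto simp: chart_at_def)

text \<open>The expression that defines \<^const>\<open>diff_rank\<close>, for arbitrary charts
instead of the chosen ones.\<close>

definition chart_rank :: "('a \<Rightarrow> 'b) \<Rightarrow> 'a set \<Rightarrow> ('a \<Rightarrow> 'e::euclidean_space) \<Rightarrow> 'b set \<Rightarrow> ('b \<Rightarrow> 'f::euclidean_space)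
    \<Rightarrow> 'a \<Rightarrow> nat" where
  "chart_rank f U \<phi> W \<psi> p = dim (frechet_derivative (\<psi> \<circ> f \<circ> inv_into U \<phi>) (at (\<phi> p) within \<phi> ` {x \<in> U. f x \<in> W})
                ` span (\<phi> ` U))"

text \<open>By the chain rule the derivative in the primed charts factors as \<open>B \<circ> D
\<circ> A\<close> with the derivatives \<open>A\<close>, \<open>B\<close> of the transition maps,
so its rank is at most that of \<open>D\<close>. Exchanging the roles of the charts yields
equality.\<close>

lemma chart_rank_le:
  assumes M: "smooth_atlas M" and N: "smooth_atlas N" and f: "smooth_map M N f"
    and U: "(U, \<phi>) \<in> atlas M" "p \<in> U" and U': "(U', \<phi>') \<in> atlas M" "p \<in> U'"
    and W: "(W, \<psi>) \<in> atlas N" "f p \<in> W" and W': "(W', \<psi>') \<in> atlas N" "f p \<in> W'"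
  shows "chart_rank f U' \<phi>' W' \<psi>' p \<le> chart_rank f U \<phi> W \<psi> p"
proof -
  note cU = smooth_atlas_chart[OF M U(1)] and cU' = smooth_atlas_chart[OF M U'(1)]
    and cW = smooth_atlas_chart[OF N W(1)] and cW' = smooth_atlas_chart[OF N W'(1)]
  define Q where "Q = {x \<in> U \<inter> U'. f x \<in> W \<inter> W'}"
  have Q: "openin (mtop M) Q" unfolding Q_def
    by (intro smooth_map_openin[OF f] openin_Int chart_openin[OF cU] chart_openin[OF cU']
        chart_openin[OF cW] chart_openin[OF cW'])
  have pQ: "p \<in> Q" using U U' W W' by (auto simp: Q_def)
  define D where "D = frechet_derivative (\<psi> \<circ> f \<circ> inv_into U \<phi>) (at (\<phi> p) within \<phi> ` {x \<in> U. f x \<in> W})"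
  define D' where "D' = frechet_derivative (\<psi>' \<circ> f \<circ> inv_into U' \<phi>') (at (\<phi>' p) within \<phi>' ` {x \<in> U'. f x \<in> W'})"
  define A where "A = frechet_derivative (\<phi> \<circ> inv_into U' \<phi>') (at (\<phi>' p) within \<phi>' ` (U' \<inter> U))"
  define B where "B = frechet_derivative (\<psi>' \<circ> inv_into W \<psi>) (at (\<psi> (f p)) within \<psi> ` (W \<inter> W'))"
  have inv: "inv_into U \<phi> (\<phi> x) = x" if "x \<in> U" for x using that chart_inj_on[OF cU] by simp
  have inv': "inv_into U' \<phi>' (\<phi>' x) = x" if "x \<in> U'" for x using that chart_inj_on[OF cU'] by simp
  have invW: "inv_into W \<psi> (\<psi> x) = x" if "x \<in> W" for x using that chart_inj_on[OF cW] by simp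
  have D: "((\<psi> \<circ> f \<circ> inv_into U \<phi>) has_derivative D) (at (\<phi> p) within \<phi> ` {x \<in> U. f x \<in> W})"
    unfolding D_def by (rule smooth_on_has_derivative[OF smooth_map_smooth_on[OF f M U(1) W(1)]])
      (use U W in auto)
  have D': "((\<psi>' \<circ> f \<circ> inv_into U' \<phi>') has_derivative D') (at (\<phi>' p) within \<phi>' ` {x \<in> U'. f x \<in> W'})"
    unfolding D'_def by (rule smooth_on_has_derivative[OF smooth_map_smooth_on[OF f M U'(1) W'(1)]])
      (use U' W' in auto)
  have A: "((\<phi> \<circ> inv_into U' \<phi>') has_derivative A) (at (\<phi>' p) within \<phi>' ` (U' \<inter> U))"
    unfolding A_def by (rule smooth_on_has_derivative[OF smooth_atlas_transition[OF M U'(1) U(1)]])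
      (use U U' in auto)
  have B: "((\<psi>' \<circ> inv_into W \<psi>) has_derivative B) (at (\<psi> (f p)) within \<psi> ` (W \<inter> W'))"
    unfolding B_def by (rule smooth_on_has_derivative[OF smooth_atlas_transition[OF N W(1) W'(1)]])
      (use W W' in auto)
  have tan: "tangential (\<phi>' ` Q) (\<phi>' p) (span (\<phi>' ` U'))"
    by (rule chart_tangential[OF cU' Q _ pQ]) (auto simp: Q_def)
  have A2: "((\<phi> \<circ> inv_into U' \<phi>') has_derivative A) (at (\<phi>' p) within \<phi>' ` Q)"
    by (rule has_derivative_subset[OF A]) (auto simp: Q_def)
  have AV: "A v \<in> span (\<phi> ` U)" if "v \<in> span (\<phi>' ` U')" for v
    by (rule derivative_into_subspace[OF A2 _ _ tan that]) (auto simp: Q_def inv' intro: span_base)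
  have BD: "((\<lambda>y. (\<psi>' \<circ> inv_into W \<psi>) ((\<psi> \<circ> f \<circ> inv_into U \<phi>) y)) has_derivative (\<lambda>v. B (D v)))
      (at ((\<phi> \<circ> inv_into U' \<phi>') (\<phi>' p)) within \<phi> ` Q)"
  proof -
    have eq: "(\<phi> \<circ> inv_into U' \<phi>') (\<phi>' p) = \<phi> p" "(\<psi> \<circ> f \<circ> inv_into U \<phi>) (\<phi> p) = \<psi> (f p)"
      using U U' inv inv' by auto
    have 1: "((\<psi> \<circ> f \<circ> inv_into U \<phi>) has_derivative D) (at ((\<phi> \<circ> inv_into U' \<phi>') (\<phi>' p)) within \<phi> ` Q)"
      unfolding eq by (rule has_derivative_subset[OF D]) (auto simp: Q_def)
    have 2: "((\<psi>' \<circ> inv_into W \<psi>) has_derivative B)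
        (at ((\<psi> \<circ> f \<circ> inv_into U \<phi>) ((\<phi> \<circ> inv_into U' \<phi>') (\<phi>' p))) within (\<psi> \<circ> f \<circ> inv_into U \<phi>) ` \<phi> ` Q)"
      unfolding eq by (rule has_derivative_subset[OF B]) (auto simp: Q_def inv)
    show ?thesis by (rule has_derivative_in_compose[OF 1 2])
  qed
  have D'eq: "D' v = B (D (A v))" if v: "v \<in> span (\<phi>' ` U')" for v
    by (rule derivative_chain_tangential[OF A2 BD _ has_derivative_subset[OF D'] _ tan v])
      (auto simp: Q_def inv inv' invW)
  have "chart_rank f U' \<phi>' W' \<psi>' p = dim (D' ` span (\<phi>' ` U'))" by (simp add: chart_rank_def D'_def)
  also have "\<dots> \<le> dim (B ` (D ` span (\<phi> ` U)))"
    by (rule dim_subset) (use D'eq AV in auto)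
  also have "\<dots> \<le> dim (D ` span (\<phi> ` U))"
    by (rule dim_image_le) (use B has_derivative_linear in blast)
  also have "\<dots> = chart_rank f U \<phi> W \<psi> p" by (simp add: chart_rank_def D_def)
  finally show ?thesis .
qed

lemma diff_rank_chart:
  assumes "smooth_atlas M" "smooth_atlas N" "smooth_map M N f"
    and "(U, \<phi>) \<in> atlas M" "p \<in> U" "(W, \<psi>) \<in> atlas N" "f p \<in> W"
  shows "diff_rank M N f p = chart_rank f U \<phi> W \<psi> p"
proof -
  obtain U' \<phi>' W' \<psi>' where c: "chart_at M p = (U', \<phi>')" "chart_at N (f p) = (W', \<psi>')" by (metis prod.exhaust)
  have "(U', \<phi>') \<in> atlas M" "p \<in> U'" "(W', \<psi>') \<in> atlas N" "f p \<in> W'"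
    using chart_at_in[OF assms(4,5)] chart_at_in[OF assms(6,7)] c by auto
  moreover have "diff_rank M N f p = chart_rank f U' \<phi>' W' \<psi>' p"
    by (simp add: diff_rank_def c chart_rank_def)
  moreover note chart_rank_le[OF assms(1-5) calculation(1,2) assms(6,7) calculation(3,4)]
    chart_rank_le[OF assms(1-3) calculation(1,2) assms(4,5) calculation(3,4) assms(6,7)]
  ultimately show ?thesis by simp
qed

section \<open>Boundary points and submersions in charts\<close>

text \<open>Rank and nullity on a subspace: a right inverse of \<open>D\<close> with values in
\<open>V\<close> splits \<open>V\<close> into the kernel and a copy of the image.\<close>

lemma dim_kernel_plus_dim_image:
  fixes D :: "'a::euclidean_space \<Rightarrow> 'b::euclidean_space"
  assumes D: "linear D" and V: "subspace V"
  shows "dim {v \<in> V. D v = 0} + dim (D ` V) = dim V"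
proof -
  obtain R where R: "range R \<subseteq> V" "linear R" "\<And>w. w \<in> D ` V \<Longrightarrow> D (R w) = w"
    using linear_exists_right_inverse_on[OF D V] by auto
  let ?K = "{v \<in> V. D v = 0}" and ?I = "D ` V"
  have K: "subspace ?K"
    using V by (auto simp: subspace_def linear_add[OF D] linear_scale[OF D] linear_0[OF D])
  have I: "subspace ?I" by (rule linear_subspace_image[OF D V])
  have RI: "subspace (R ` ?I)" by (rule linear_subspace_image[OF R(2) I])
  have "inj_on R (span ?I)"
    by (rule inj_on_inverseI[of _ D]) (use R(3) I in \<open>simp add: span_eq_iff[THEN iffD2]\<close>)
  then have 1: "dim (R ` ?I) = dim ?I" by (rule dim_image_eq[OF R(2)])
  have "?K \<inter> R ` ?I = {0}"
    using R(3) subspace_0[OF K] subspace_0[OF RI] linear_0[OF R(2)] by auto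
  then have 2: "dim (?K \<inter> R ` ?I) = 0" by simp
  have "{x + y |x y. x \<in> ?K \<and> y \<in> R ` ?I} = V"
  proof
    show "V \<subseteq> {x + y |x y. x \<in> ?K \<and> y \<in> R ` ?I}"
    proof
      fix v assume v: "v \<in> V"
      have "R (D v) \<in> V" using R(1) by auto
      then have "v - R (D v) \<in> ?K" using v V R(3) by (auto simp: linear_diff[OF D] subspace_diff)
      moreover have "v = (v - R (D v)) + R (D v)" by simp
      ultimately show "v \<in> {x + y |x y. x \<in> ?K \<and> y \<in> R ` ?I}" using v by blast
    qed
  qed (use R(1) V in \<open>auto intro!: subspace_add\<close>)
  with dim_sums_Int[OF K RI] 1 2 show ?thesis by simp
qed

lemma transition_derivative:
  assumes M: "smooth_atlas M" and U: "(U, \<phi>) \<in> atlas M" "p \<in> U" and W: "(W, \<psi>) \<in> atlas M" "p \<in> W"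
    and A: "((\<psi> \<circ> inv_into U \<phi>) has_derivative A) (at (\<phi> p) within \<phi> ` (U \<inter> W))"
    and B: "((\<phi> \<circ> inv_into W \<psi>) has_derivative B) (at (\<psi> p) within \<psi> ` (W \<inter> U))"
    and v: "v \<in> span (\<phi> ` U)"
  shows "A v \<in> span (\<psi> ` W)" "B (A v) = v"
proof -
  note cU = smooth_atlas_chart[OF M U(1)] and cW = smooth_atlas_chart[OF M W(1)]
  have inv: "inv_into U \<phi> (\<phi> x) = x" if "x \<in> U" for x using that chart_inj_on[OF cU] by simp
  have inv': "inv_into W \<psi> (\<psi> x) = x" if "x \<in> W" for x using that chart_inj_on[OF cW] by simp
  have tan: "tangential (\<phi> ` (U \<inter> W)) (\<phi> p) (span (\<phi> ` U))"
    by (rule chart_tangential[OF cU]) (use U W in \<open>auto intro!: openin_Int chart_openin[OF cU] chart_openin[OF cW]\<close>)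
  show "A v \<in> span (\<psi> ` W)"
    by (rule derivative_into_subspace[OF A subspace_span _ tan v]) (auto simp: inv intro: span_base)
  have "(\<psi> \<circ> inv_into U \<phi>) (\<phi> p) = \<psi> p" using U by (simp add: inv)
  with B have B': "((\<phi> \<circ> inv_into W \<psi>) has_derivative B) (at ((\<psi> \<circ> inv_into U \<phi>) (\<phi> p)) within \<psi> ` (W \<inter> U))"
    by simp
  show "B (A v) = v"
    by (rule derivative_left_inverse_tangential[OF A B' _ _ tan v, where a=0]) (auto simp: inv inv')
qed

text \<open>A boundary point is a boundary point in every chart. Otherwise it would be an interior
point in the chart \<open>\<phi>\<close>, and the function \<open>(\<psi> \<circ>
\<phi>\<inverse>) \<bullet> \<nu>'\<close>, which is nonnegative and vanishes at this point, would
have a minimum there along every line. Its derivative would vanish, but the derivative of the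
transition map reaches \<open>\<nu>'\<close>, and \<open>\<nu>' \<bullet> \<nu>' \<noteq>
0\<close>.\<close>

lemma boundary_point_in_chart:
  assumes M: "smooth_atlas M" and U: "(U, \<phi>) \<in> atlas M" "p \<in> U" and p: "p \<in> boundary_points M"
    and V: "subspace V" "openin (top_of_set (half_space V \<nu>)) (\<phi> ` U)"
  shows "\<nu> \<noteq> 0" "\<phi> p \<bullet> \<nu> = 0"
proof -
  obtain W \<psi> V' \<nu>' where W: "(W, \<psi>) \<in> atlas M" "p \<in> W" and V': "subspace V'" "\<nu>' \<in> V'" "\<nu>' \<noteq> 0"
    "openin (top_of_set (half_space V' \<nu>')) (\<psi> ` W)" "\<psi> p \<bullet> \<nu>' = 0"
    using p unfolding boundary_points_def by blast
  note cU = smooth_atlas_chart[OF M U(1)] and cW = smooth_atlas_chart[OF M W(1)]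
  have inv: "inv_into U \<phi> (\<phi> x) = x" if "x \<in> U" for x using that chart_inj_on[OF cU] by simp
  have sV: "span (\<phi> ` U) = V" "span (\<psi> ` W) = V'"
    using open_in_half_space_tangential(2)[OF V imageI[OF U(2)]]
      open_in_half_space_tangential(2)[OF V'(1,4) imageI[OF W(2)]] .
  define A where "A = frechet_derivative (\<psi> \<circ> inv_into U \<phi>) (at (\<phi> p) within \<phi> ` (U \<inter> W))"
  define B where "B = frechet_derivative (\<phi> \<circ> inv_into W \<psi>) (at (\<psi> p) within \<psi> ` (W \<inter> U))"
  have A: "((\<psi> \<circ> inv_into U \<phi>) has_derivative A) (at (\<phi> p) within \<phi> ` (U \<inter> W))"
    unfolding A_def by (rule smooth_on_has_derivative[OF smooth_atlas_transition[OF M U(1) W(1)]]) (use U W in auto)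
  have B: "((\<phi> \<circ> inv_into W \<psi>) has_derivative B) (at (\<psi> p) within \<psi> ` (W \<inter> U))"
    unfolding B_def by (rule smooth_on_has_derivative[OF smooth_atlas_transition[OF M W(1) U(1)]]) (use U W in auto)
  \<comment> \<open>The transition map sends this direction to the inner normal
  \<open>\<nu>'\<close>.\<close>
  define v where "v = B \<nu>'"
  have v: "v \<in> V" "A v = \<nu>'"
    using transition_derivative[OF M W U B A] V'(2) by (auto simp: sV v_def)
  have "\<not> (\<nu> = 0 \<or> 0 < \<phi> p \<bullet> \<nu>)"
  proof
    assume int: "\<nu> = 0 \<or> 0 < \<phi> p \<bullet> \<nu>"
    obtain N where N: "open N" "\<phi> ` (U \<inter> W) = \<phi> ` U \<inter> N"
      by (rule chart_image_openin[OF cU openin_Int[OF chart_openin[OF cU] chart_openin[OF cW]] Int_lower1])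
    obtain N' where N': "open N'" "\<phi> ` U = half_space V \<nu> \<inter> N'" using V(2) by (auto simp: openin_open)
    have "\<phi> p \<in> \<phi> ` (U \<inter> W)" using U W by auto
    then have p': "\<phi> p \<in> N" "\<phi> p \<in> N'" "\<phi> p \<in> V"
      unfolding N(2) N'(2) by (auto simp: half_space_def)
    define \<gamma> :: "real \<Rightarrow> _" where "\<gamma> \<tau> = \<phi> p + \<tau> *\<^sub>R v" for \<tau>
    have \<gamma>: "continuous_on UNIV \<gamma>" unfolding \<gamma>_def by (intro continuous_intros)
    define P where "P = (if \<nu> = 0 then UNIV else {y. 0 < y \<bullet> \<nu>})"
    have P: "open P" "\<phi> p \<in> P" using int unfolding P_def
      by (auto intro!: open_Collect_less continuous_intros)
    define T where "T = \<gamma> -` (N \<inter> N' \<inter> P)"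
    have T: "open T" "0 \<in> T"
      using N N' P p' by (auto simp: T_def \<gamma>_def[of 0] intro!: open_vimage[OF _ \<gamma>])
    have TS: "\<gamma> \<tau> \<in> \<phi> ` (U \<inter> W)" if "\<tau> \<in> T" for \<tau>
    proof -
      have "\<gamma> \<tau> \<in> V" unfolding \<gamma>_def using p'(3) v(1) V(1) by (intro subspace_add subspace_scale)
      with that show ?thesis unfolding N(2) N'(2) by (auto simp: T_def P_def half_space_def split: if_splits)
    qed
    have d\<gamma>: "(\<gamma> has_derivative (\<lambda>\<tau>. \<tau> *\<^sub>R v)) (at 0 within T)"
      unfolding \<gamma>_def by (auto intro!: derivative_eq_intros)
    have "((\<psi> \<circ> inv_into U \<phi>) has_derivative A) (at (\<gamma> 0) within \<gamma> ` T)"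
      by (rule has_derivative_subset[of _ _ _ "\<phi> ` (U \<inter> W)"]) (use A TS in \<open>auto simp: \<gamma>_def[of 0]\<close>)
    from has_derivative_inner_left[OF has_derivative_in_compose[OF d\<gamma> this], of \<nu>']
    have "((\<lambda>\<tau>. (\<psi> \<circ> inv_into U \<phi>) (\<gamma> \<tau>) \<bullet> \<nu>') has_derivative (\<lambda>\<tau>. A (\<tau> *\<^sub>R v) \<bullet> \<nu>')) (at 0)"
      unfolding at_within_open[OF T(2,1)] .
    moreover have "\<forall>\<tau>\<in>T. (\<psi> \<circ> inv_into U \<phi>) (\<gamma> 0) \<bullet> \<nu>' \<le> (\<psi> \<circ> inv_into U \<phi>) (\<gamma> \<tau>) \<bullet> \<nu>'"
    proof
      fix \<tau> assume "\<tau> \<in> T"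
      then obtain q where q: "q \<in> U" "q \<in> W" "\<gamma> \<tau> = \<phi> q" using TS by auto
      then have "\<psi> q \<in> half_space V' \<nu>'" using openin_subset[OF V'(4)] by auto
      then show "(\<psi> \<circ> inv_into U \<phi>) (\<gamma> 0) \<bullet> \<nu>' \<le> (\<psi> \<circ> inv_into U \<phi>) (\<gamma> \<tau>) \<bullet> \<nu>'"
        using q U V'(5) by (simp add: inv half_space_def \<gamma>_def[of 0])
    qed
    ultimately have "(\<lambda>\<tau>. A (\<tau> *\<^sub>R v) \<bullet> \<nu>') = (\<lambda>\<tau>. 0)"
      using T by (intro differential_zero_maxmin[of 0 T]) auto
    from fun_cong[OF this, of 1] have "A v \<bullet> \<nu>' = 0" by simp
    with v V' show False by simp
  qed
  moreover have "0 \<le> \<phi> p \<bullet> \<nu>" using openin_subset[OF V(2)] U by (auto simp: half_space_def)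
  ultimately show "\<nu> \<noteq> 0" "\<phi> p \<bullet> \<nu> = 0" by auto
qed

text \<open>Interior and boundary points are brought into a common form: near the image of
\<open>p\<close> the chart is a half space whose boundary hyperplane passes through it, and the
differential maps the hyperplane onto the tangent space of the target. For a boundary point this
is the submersion property of the restriction to the boundary; at an interior point one takes
\<open>\<nu> = 0\<close>, for which half space and hyperplane are all of \<open>V\<close>.\<close>

lemma boundary_submersion_model:
  assumes M: "smooth_manifold M" and N: "smooth_manifold N"
    and f: "submersion M N f" and bf: "submersion (boundary_manifold M) N f" and p: "p \<in> points M"
  obtains U \<phi> W \<psi> V \<nu> Om D where "(U, \<phi>) \<in> atlas M" "p \<in> U" "(W, \<psi>) \<in> atlas N" "f p \<in> W"
    "subspace V" "dim V = mdim M" "\<nu> \<in> V" "\<phi> p \<in> V" "\<phi> p \<bullet> \<nu> = 0" "V = span (\<phi> ` U)"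
    "open Om" "\<phi> p \<in> Om" "half_space V \<nu> \<inter> Om = \<phi> ` {q \<in> U. f q \<in> W} \<inter> Om"
    "((\<psi> \<circ> f \<circ> inv_into U \<phi>) has_derivative D) (at (\<phi> p) within \<phi> ` {q \<in> U. f q \<in> W})"
    "span (\<psi> ` W) \<subseteq> D ` (V \<inter> {v. v \<bullet> \<nu> = 0})"
proof -
  note aM = smooth_manifold_atlas[OF M] and aN = smooth_manifold_atlas[OF N]
  have sf: "smooth_map M N f" using f by (simp add: submersion_def)
  have fp: "f p \<in> points N" using sf p by (auto simp: smooth_map_on_def continuous_map_def)
  obtain W0 \<psi>0 where "(W0, \<psi>0) \<in> atlas N" "f p \<in> W0" using N fp unfolding smooth_manifold_def by blast
  then obtain W \<psi> where W: "chart_at N (f p) = (W, \<psi>)" "(W, \<psi>) \<in> atlas N" "f p \<in> W"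
    using chart_at_in by (metis prod.collapse)
  note cW = smooth_atlas_chart[OF aN W(2)]
  obtain U0 \<phi>0 where U0: "(U0, \<phi>0) \<in> atlas M" "p \<in> U0" using M p unfolding smooth_manifold_def by blast
  note witness = that
  have fin: thesis if "(U, \<phi>) \<in> atlas M" "p \<in> U" and V: "subspace V" "dim V = mdim M" "\<nu> \<in> V" "\<phi> p \<bullet> \<nu> = 0"
    and Om: "open Om" "\<phi> p \<in> Om" "half_space V \<nu> \<inter> Om = \<phi> ` {q \<in> U. f q \<in> W} \<inter> Om"
    and sp: "V = span (\<phi> ` U)" and 
    on: "\<And>D. ((\<psi> \<circ> f \<circ> inv_into U \<phi>) has_derivative D) (at (\<phi> p) within \<phi> ` {q \<in> U. f q \<in> W}) \<Longrightarrow>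
       dim (D ` (V \<inter> {v. v \<bullet> \<nu> = 0})) \<ge> mdim N"
    for U \<phi> V \<nu> Om
  proof -
    note cU = smooth_atlas_chart[OF aM that(1)]
    define D where "D = frechet_derivative (\<psi> \<circ> f \<circ> inv_into U \<phi>) (at (\<phi> p) within \<phi> ` {q \<in> U. f q \<in> W})"
    have D: "((\<psi> \<circ> f \<circ> inv_into U \<phi>) has_derivative D) (at (\<phi> p) within \<phi> ` {q \<in> U. f q \<in> W})"
      unfolding D_def by (rule smooth_on_has_derivative[OF smooth_map_smooth_on[OF sf aM that(1) W(2)]])
        (use that W in auto)
    have "tangential (\<phi> ` {q \<in> U. f q \<in> W}) (\<phi> p) V"
      unfolding sp by (rule chart_tangential[OF cU])
        (use that W in \<open>auto intro!: smooth_map_openin[OF sf] chart_openin[OF cU] chart_openin[OF cW]\<close>)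
    then have "D v \<in> span (\<psi> ` W)" if "v \<in> V" for v
      using chart_inj_on[OF cU]
      by (intro derivative_into_subspace[OF D subspace_span _ _ that]) (auto intro: span_base)
    then have sub: "D ` (V \<inter> {v. v \<bullet> \<nu> = 0}) \<subseteq> span (\<psi> ` W)" by auto
    have "subspace (V \<inter> {v. v \<bullet> \<nu> = 0})"
      using V(1) subspace_hyperplane[of \<nu>] by (intro subspace_inter) (auto simp: inner_commute)
    then have "subspace (D ` (V \<inter> {v. v \<bullet> \<nu> = 0}))"
      using D has_derivative_linear linear_subspace_image by blast
    then have eq: "D ` (V \<inter> {v. v \<bullet> \<nu> = 0}) = span (\<psi> ` W)"
      using sub on[OF D] chart_dim[OF cW W(3)] by (intro subspace_dim_equal) auto
    have "\<phi> p \<in> V" unfolding sp using that by (auto intro: span_base)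
    then show thesis using that(1,2) W V Om sp D eq by (intro witness) auto
  qed
  show thesis
  proof (cases "p \<in> boundary_points M")
    case False
    obtain U \<phi> where U: "chart_at M p = (U, \<phi>)" "(U, \<phi>) \<in> atlas M" "p \<in> U"
      using chart_at_in[OF U0] by (metis prod.collapse)
    note cU = smooth_atlas_chart[OF aM U(2)]
    define V where "V = span (\<phi> ` U)"
    obtain \<nu> where \<nu>: "\<nu> \<in> V" "openin (top_of_set (half_space V \<nu>)) (\<phi> ` U)" "dim V = mdim M"
      using chart_half_space[OF cU U(3)] unfolding V_def by blast
    define P where "P = (if \<nu> = 0 then UNIV else {y. 0 < y \<bullet> \<nu>})"
    have oP: "open P"
      by (auto simp: P_def intro!: open_Collect_less continuous_intros)
    have "\<phi> p \<bullet> \<nu> \<noteq> 0" if "\<nu> \<noteq> 0"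
      using False that \<nu> U unfolding boundary_points_def V_def by blast
    moreover have "0 \<le> \<phi> p \<bullet> \<nu>" using openin_subset[OF \<nu>(2)] U by (auto simp: half_space_def)
    ultimately have pP: "\<phi> p \<in> P" by (auto simp: P_def less_le)
    have "openin (mtop M) {q \<in> U. f q \<in> W}"
      by (intro smooth_map_openin[OF sf] chart_openin[OF cU] chart_openin[OF cW])
    then obtain N1 where N1: "open N1" "\<phi> ` {q \<in> U. f q \<in> W} = \<phi> ` U \<inter> N1"
      using chart_image_openin[OF cU] by (metis (no_types, lifting) mem_Collect_eq subsetI)
    obtain N2 where N2: "open N2" "\<phi> ` U = half_space V \<nu> \<inter> N2" using \<nu>(2) by (auto simp: openin_open)
    have pN: "\<phi> p \<in> N1" "\<phi> p \<in> N2" using N1 N2 U W by blast+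
    show thesis
    proof (rule fin[OF U(2,3), where \<nu>=0 and V=V and Om="N1 \<inter> N2 \<inter> P"])
      show "half_space V 0 \<inter> (N1 \<inter> N2 \<inter> P) = \<phi> ` {q \<in> U. f q \<in> W} \<inter> (N1 \<inter> N2 \<inter> P)"
        unfolding N1(2) N2(2) by (auto simp: half_space_def P_def split: if_splits)
      fix D assume D: "((\<psi> \<circ> f \<circ> inv_into U \<phi>) has_derivative D) (at (\<phi> p) within \<phi> ` {q \<in> U. f q \<in> W})"
      define D1 where "D1 = frechet_derivative (\<psi> \<circ> f \<circ> inv_into U \<phi>) (at (\<phi> p) within \<phi> ` {q \<in> U. f q \<in> W})"
      have D1: "((\<psi> \<circ> f \<circ> inv_into U \<phi>) has_derivative D1) (at (\<phi> p) within \<phi> ` {q \<in> U. f q \<in> W})"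
        using D by (auto simp: D1_def frechet_derivative_works[symmetric] differentiable_def)
      have "tangential (\<phi> ` {q \<in> U. f q \<in> W}) (\<phi> p) V"
        unfolding V_def by (rule chart_tangential[OF cU])
          (use U W in \<open>auto intro!: smooth_map_openin[OF sf] chart_openin[OF cU] chart_openin[OF cW]\<close>)
      from derivative_unique_tangential[OF D D1 _ this] have "D ` V = D1 ` V" by (intro image_cong) auto
      moreover have "dim (D1 ` V) = mdim N"
        using f p by (auto simp: submersion_def diff_rank_def U(1) W(1) D1_def V_def)
      ultimately show "mdim N \<le> dim (D ` (V \<inter> {v. v \<bullet> 0 = 0}))" by simp
    next
      show "subspace V" unfolding V_def by simp
      then show "0 \<in> V" by (rule subspace_0)
      show "open (N1 \<inter> N2 \<inter> P)" using N1(1) N2(1) oP by auto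
      show "\<phi> p \<in> N1 \<inter> N2 \<inter> P" using pN pP by auto
    qed (rule \<nu>(3) V_def inner_zero_right)+
  next
    case True
    let ?B = "boundary_points M"
    have "(U0 \<inter> ?B, \<phi>0) \<in> atlas (boundary_manifold M)" using U0 by (force simp: boundary_manifold_def)
    then have "chart_at (boundary_manifold M) p \<in> atlas (boundary_manifold M)"
      "p \<in> fst (chart_at (boundary_manifold M) p)"
      using chart_at_in U0 True by (metis Int_iff)+
    then obtain U \<phi> where U: "chart_at (boundary_manifold M) p = (U \<inter> ?B, \<phi>)" "(U, \<phi>) \<in> atlas M" "p \<in> U"
      by (auto simp: boundary_manifold_def)
    note cU = smooth_atlas_chart[OF aM U(2)]
    define V where "V = span (\<phi> ` U)"
    have sV: "subspace V" by (simp add: V_def)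
    obtain \<nu> where \<nu>: "\<nu> \<in> V" "openin (top_of_set (half_space V \<nu>)) (\<phi> ` U)" "dim V = mdim M"
      using chart_half_space[OF cU U(3)] unfolding V_def by blast
    have bd: "\<phi> q \<bullet> \<nu> = 0" if "q \<in> U" "q \<in> ?B" for q
      using boundary_point_in_chart(2)[OF aM U(2) that sV \<nu>(2)] .
    have \<nu>0: "\<nu> \<noteq> 0" using boundary_point_in_chart(1)[OF aM U(2,3) True sV \<nu>(2)] .
    have bd': "q \<in> ?B" if "q \<in> U" "\<phi> q \<bullet> \<nu> = 0" for q
      using that U(2) \<nu> \<nu>0 sV unfolding boundary_points_def by blast
    have "openin (mtop M) {q \<in> U. f q \<in> W}"
      by (intro smooth_map_openin[OF sf] chart_openin[OF cU] chart_openin[OF cW])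
    then obtain N1 where N1: "open N1" "\<phi> ` {q \<in> U. f q \<in> W} = \<phi> ` U \<inter> N1"
      using chart_image_openin[OF cU] by (metis (no_types, lifting) mem_Collect_eq subsetI)
    obtain N2 where N2: "open N2" "\<phi> ` U = half_space V \<nu> \<inter> N2" using \<nu>(2) by (auto simp: openin_open)
    have pN: "\<phi> p \<in> N1" "\<phi> p \<in> N2" using N1 N2 U W by blast+
    show thesis
    proof (rule fin[OF U(2,3), where \<nu>=\<nu> and V=V and Om="N1 \<inter> N2"])
      show "half_space V \<nu> \<inter> (N1 \<inter> N2) = \<phi> ` {q \<in> U. f q \<in> W} \<inter> (N1 \<inter> N2)"
        unfolding N1(2) N2(2) by auto
      show "\<phi> p \<bullet> \<nu> = 0" using bd U True by simp
      fix D assume D: "((\<psi> \<circ> f \<circ> inv_into U \<phi>) has_derivative D) (at (\<phi> p) within \<phi> ` {q \<in> U. f q \<in> W})"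
      \<comment> \<open>The derivative in the boundary chart is the restriction of \<open>D\<close> to
      the boundary hyperplane.\<close>
      let ?S = "\<phi> ` {q \<in> U \<inter> ?B. f q \<in> W}" and ?H = "V \<inter> {v. v \<bullet> \<nu> = 0}"
      define D1 where "D1 = frechet_derivative (\<psi> \<circ> f \<circ> inv_into (U \<inter> ?B) \<phi>) (at (\<phi> p) within ?S)"
      have Dsub: "((\<psi> \<circ> f \<circ> inv_into U \<phi>) has_derivative D) (at (\<phi> p) within ?S)"
        by (rule has_derivative_subset[OF D]) auto
      have D2: "((\<psi> \<circ> f \<circ> inv_into (U \<inter> ?B) \<phi>) has_derivative D) (at (\<phi> p) within ?S)"
      proof (rule has_derivative_transform[OF _ _ Dsub])
        show "\<phi> p \<in> ?S" using U W True by auto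
        fix y assume "y \<in> ?S"
        then obtain q where "q \<in> U \<inter> ?B" "y = \<phi> q" by auto
        then show "(\<psi> \<circ> f \<circ> inv_into (U \<inter> ?B) \<phi>) y = (\<psi> \<circ> f \<circ> inv_into U \<phi>) y"
          using chart_inj_on[OF cU] inj_on_subset[OF chart_inj_on[OF cU], of "U \<inter> ?B"]
          by (simp add: inv_into_f_f)
      qed
      then have D1: "((\<psi> \<circ> f \<circ> inv_into (U \<inter> ?B) \<phi>) has_derivative D1) (at (\<phi> p) within ?S)"
        by (auto simp: D1_def frechet_derivative_works[symmetric] differentiable_def)
      have sH: "subspace ?H"
        using sV subspace_hyperplane[of \<nu>] by (intro subspace_inter) (auto simp: inner_commute)
      have hs: "half_space ?H 0 = half_space V \<nu> \<inter> {v. v \<bullet> \<nu> = 0}" by (auto simp: half_space_def)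
      have pH: "\<phi> p \<in> half_space ?H 0"
        using bd[OF U(3) True] U(3) by (auto simp: half_space_def V_def intro: span_base)
      have "half_space ?H 0 \<inter> (N1 \<inter> N2) \<subseteq> ?S"
      proof
        fix y assume y: "y \<in> half_space ?H 0 \<inter> (N1 \<inter> N2)"
        then have "y \<in> \<phi> ` {q \<in> U. f q \<in> W}" unfolding N1(2) N2(2) hs by auto
        then obtain q where "q \<in> U" "f q \<in> W" "y = \<phi> q" by auto
        moreover have "\<phi> q \<bullet> \<nu> = 0" using y calculation by (auto simp: half_space_def)
        ultimately show "y \<in> ?S" using bd' by auto
      qed
      moreover have "tangential (half_space ?H 0 \<inter> (N1 \<inter> N2)) (\<phi> p) ?H"
        using N1(1) N2(1) pN by (intro tangential_half_space[OF sH pH]) auto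
      ultimately have tan: "tangential ?S (\<phi> p) ?H" using tangential_mono by blast
      have "span (\<phi> ` (U \<inter> ?B)) \<subseteq> ?H"
        using bd by (intro span_minimal sH) (auto simp: V_def intro: span_base)
      moreover have "D1 v = D v" if "v \<in> ?H" for v
        by (rule derivative_unique_tangential[OF D1 D2 _ tan that]) auto
      ultimately have "D1 ` span (\<phi> ` (U \<inter> ?B)) \<subseteq> D ` ?H" by (metis (no_types, lifting) image_cong image_mono)
      then have "dim (D1 ` span (\<phi> ` (U \<inter> ?B))) \<le> dim (D ` ?H)" by (rule dim_subset)
      moreover have "p \<in> points (boundary_manifold M)" using p True by (auto simp: boundary_manifold_def)
      then have "dim (D1 ` span (\<phi> ` (U \<inter> ?B))) = mdim N"
        using bf by (auto simp: submersion_def diff_rank_def U(1) W(1) D1_def)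
      ultimately show "mdim N \<le> dim (D ` ?H)" by simp
    next
      show "open (N1 \<inter> N2)" using N1(1) N2(1) by auto
      show "\<phi> p \<in> N1 \<inter> N2" using pN by auto
    qed (rule \<nu>(3) \<nu>(1) sV V_def)+
  qed
qed

section \<open>Charts of the fibres of a submersion\<close>

text \<open>Choose a right inverse \<open>R\<close> of \<open>DG\<close> with values in the
hyperplane \<open>V \<inter> {v. v \<bullet> \<nu> = 0}\<close> and put \<open>F y = (y - y0) + R
(G y - G y0 - DG (y - y0))\<close>. The differential of \<open>F\<close> at \<open>y0\<close> is
the identity, so \<open>F\<close> is a local diffeomorphism. It moves points of the half space
parallel to the boundary hyperplane, up to the translation by \<open>y0\<close>, which lies in
that hyperplane; hence it respects the half space. Finally \<open>DG (F y) = G y - G y0\<close>,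
so the fibre of \<open>G\<close> becomes the kernel of \<open>DG\<close>.\<close>

lemma straighten_submersion:
  fixes G :: "'e::euclidean_space \<Rightarrow> 'f::euclidean_space"
  assumes dG: "(G has_derivative DG) (at y0)" and V: "subspace V" and y0: "y0 \<in> V" "y0 \<bullet> \<nu> = 0" and O1: "open O1" "y0 \<in> O1"
    and G: "\<And>k. Ck_on k O1 G" and vals: "\<And>y. y \<in> half_space V \<nu> \<inter> O1 \<Longrightarrow> G y - G y0 \<in> Y"
    and DV: "DG ` V \<subseteq> Y" and onto: "Y \<subseteq> DG ` (V \<inter> {v. v \<bullet> \<nu> = 0})" and Y: "subspace Y"
  obtains O' Q F H where "open O'" "O' \<subseteq> O1" "y0 \<in> O'" "open Q" "homeomorphism O' Q F H"
    "\<And>k. Ck_on k O' F" "\<And>k. Ck_on k Q H"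
    "\<And>y. y \<in> O' \<Longrightarrow> F y \<in> half_space V \<nu> \<longleftrightarrow> y \<in> half_space V \<nu>"
    "\<And>y. y \<in> half_space V \<nu> \<inter> O' \<Longrightarrow> DG (F y) = 0 \<longleftrightarrow> G y = G y0"
proof -
  let ?H = "V \<inter> {v. v \<bullet> \<nu> = 0}"
  from dG have lin: "linear DG" by (rule has_derivative_linear)
  have "subspace ?H"
    using V subspace_hyperplane[of \<nu>] by (intro subspace_inter) (auto simp: inner_commute)
  then obtain R where R: "range R \<subseteq> ?H" "linear R" "\<And>w. w \<in> DG ` ?H \<Longrightarrow> DG (R w) = w"
    using linear_exists_right_inverse_on[OF lin] by metis
  define F where "F y = (y + (- y0)) + R (G y + (- G y0 + - DG (y + (- y0))))" for y
  have bR: "bounded_linear R" and bD: "bounded_linear DG"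
    using R(2) lin by (auto simp: linear_conv_bounded_linear)
  have CF: "Ck_on k O1 F" for k
    unfolding F_def
    by (intro Ck_on_add Ck_on_bounded_linear[OF O1(1) bR] Ck_on_id Ck_on_const O1 G
        Ck_on_bounded_linear[OF O1(1) bounded_linear_minus[OF bD]])
  have "(F has_derivative (\<lambda>v. (v + 0) + R (DG v + (0 + - DG (v + 0))))) (at y0)"
    unfolding F_def
    by (intro has_derivative_add has_derivative_ident has_derivative_const bounded_linear.has_derivative[OF bR]
        has_derivative_minus bounded_linear.has_derivative[OF bD] dG)
  then have "frechet_derivative F (at y0) v = v" for v
    using frechet_derivative_at[of F _ y0] linear_0[OF R(2)] by fastforce
  then obtain O' Q H where *: "open O'" "O' \<subseteq> O1" "y0 \<in> O'" "open Q" "homeomorphism O' Q F H" "\<And>k. Ck_on k Q H"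
    using smooth_inverse_function[OF O1 CF] by blast
  have RH: "R w \<in> V" "R w \<bullet> \<nu> = 0" for w using R(1) by auto
  have half: "F y \<in> half_space V \<nu> \<longleftrightarrow> y \<in> half_space V \<nu>" for y
  proof -
    define c where "c = - y0 + R (G y + (- G y0 + - DG (y + (- y0))))"
    have c: "c \<in> V" unfolding c_def by (intro subspace_add subspace_neg V y0 RH)
    have c': "c \<bullet> \<nu> = 0" by (simp add: c_def inner_add_left inner_diff_left RH y0)
    have Fc: "F y = y + c" by (simp add: F_def c_def)
    have "y \<in> V" if "F y \<in> V" using subspace_diff[OF V that c] Fc by simp
    then have "F y \<in> V \<longleftrightarrow> y \<in> V" using Fc subspace_add[OF V _ c] by auto
    then show ?thesis using Fc c' by (simp add: half_space_def inner_add_left)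
  qed
  have ker: "DG (F y) = G y - G y0" if y: "y \<in> half_space V \<nu> \<inter> O'" for y
  proof -
    have "y - y0 \<in> V" using y y0 V by (auto simp: half_space_def subspace_diff)
    moreover have "G y - G y0 \<in> Y" using vals[of y] y *(2) by auto
    moreover have "DG (y - y0) \<in> Y" using DV calculation by blast
    ultimately have "G y - G y0 - DG (y - y0) \<in> Y" using subspace_diff[OF Y] by blast
    then have "DG (R (G y - G y0 - DG (y - y0))) = G y - G y0 - DG (y - y0)" using R(3) onto by auto
    moreover have "F y = (y - y0) + R (G y - G y0 - DG (y - y0))" by (simp add: F_def algebra_simps)
    ultimately show ?thesis by (simp add: linear_add[OF lin])
  qed
  show thesis
    by (rule that[OF *(1-5) Ck_on_subset[OF CF *(2)] *(6) half]) (use ker in auto)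
qed

text \<open>The fibre chart is \<open>F \<circ> \<phi>\<close> with the straightening map
\<open>F\<close>. Its image is an open piece of a half space in the kernel of the differential, so
boundary points of \<open>M\<close> cause no corners. The inclusion is \<open>F\<inverse>\<close>
in coordinates, and \<open>F\<close> itself is a left inverse, whence the inclusion is an
immersion in every chart of \<open>M\<close>.\<close>

lemma fibre_chart_exists:
  assumes M: "smooth_manifold M" and N: "smooth_manifold N"
    and f: "submersion M N f" and bf: "submersion (boundary_manifold M) N f" and p: "p \<in> points M"
  shows "\<exists>(W, \<psi>) \<in> atlas (submanifold M (mdim M - mdim N) {q \<in> points M. f q = f p}). p \<in> W"
proof -
  note aM = smooth_manifold_atlas[OF M] and aN = smooth_manifold_atlas[OF N]
  obtain U \<phi> W \<psi> V \<nu> N1 D where U: "(U, \<phi>) \<in> atlas M" "p \<in> U" and W: "(W, \<psi>) \<in> atlas N" "f p \<in> W"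
    and V: "subspace V" "dim V = mdim M" "\<nu> \<in> V" "\<phi> p \<in> V" "\<phi> p \<bullet> \<nu> = 0" "V = span (\<phi> ` U)"
    and N1: "open N1" "\<phi> p \<in> N1" "half_space V \<nu> \<inter> N1 = \<phi> ` {q \<in> U. f q \<in> W} \<inter> N1"
    and D: "((\<psi> \<circ> f \<circ> inv_into U \<phi>) has_derivative D) (at (\<phi> p) within \<phi> ` {q \<in> U. f q \<in> W})"
    and onto: "span (\<psi> ` W) \<subseteq> D ` (V \<inter> {v. v \<bullet> \<nu> = 0})"
    using boundary_submersion_model[OF M N f bf p] .
  note cU = smooth_atlas_chart[OF aM U(1)] and cW = smooth_atlas_chart[OF aN W(1)]
  have sf: "smooth_map M N f" using f by (simp add: submersion_def)
  have inv: "inv_into U \<phi> (\<phi> x) = x" if "x \<in> U" for x using that chart_inj_on[OF cU] by simp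
  let ?S = "\<phi> ` {q \<in> U. f q \<in> W}" and ?Y = "span (\<psi> ` W)"
  have pS: "\<phi> p \<in> ?S" using U W by auto
  obtain U0 G where G: "open U0" "\<phi> p \<in> U0" "\<And>k. Ck_on k U0 G"
    and GS: "\<And>y. y \<in> ?S \<inter> U0 \<Longrightarrow> (\<psi> \<circ> f \<circ> inv_into U \<phi>) y = G y"
    using smooth_on_extension[OF smooth_map_smooth_on[OF sf aM U(1) W(1)] pS] by blast
  define DG where "DG = frechet_derivative G (at (\<phi> p))"
  define y0 where "y0 = \<phi> p"
  define O1 where "O1 = U0 \<inter> N1"
  have O1: "open O1" "y0 \<in> O1" using G N1 by (auto simp: O1_def y0_def)
  have Gq: "G (\<phi> q) = \<psi> (f q)" if "q \<in> U" "f q \<in> W" "\<phi> q \<in> O1" for q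
    using GS[of "\<phi> q"] that by (auto simp: inv O1_def)
  have Gp: "G y0 = \<psi> (f p)" using Gq[of p] U W O1 by (simp add: y0_def)
  have hO: "\<exists>q. q \<in> U \<and> f q \<in> W \<and> y = \<phi> q" if "y \<in> half_space V \<nu>" "y \<in> O1" for y
  proof -
    have "y \<in> half_space V \<nu> \<inter> N1" using that by (auto simp: O1_def)
    then show ?thesis unfolding N1(3) by auto
  qed
  have tan: "tangential ?S y0 V"
    unfolding V(6) y0_def by (rule chart_tangential[OF cU])
      (use U W in \<open>auto intro!: smooth_map_openin[OF sf] chart_openin[OF cU] chart_openin[OF cW]\<close>)
  have dG: "(G has_derivative DG) (at y0)"
    using G(3)[of 1] G(2) by (auto simp: DG_def y0_def frechet_derivative_works)
  then have lin: "linear DG" by (rule has_derivative_linear)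
  have DGD: "DG v = D v" if "v \<in> V" for v
  proof (rule derivative_unique_tangential[OF _ _ _ _ that])
    show "(G has_derivative DG) (at y0 within ?S \<inter> U0)" using dG by (rule has_derivative_at_withinI)
    show "((\<psi> \<circ> f \<circ> inv_into U \<phi>) has_derivative D) (at y0 within ?S \<inter> U0)"
      unfolding y0_def by (rule has_derivative_subset[OF D]) auto
    show "tangential (?S \<inter> U0) y0 V" using tangential_Int_open[OF tan] G by (simp add: y0_def)
  qed (use GS in auto)
  have DY: "D v \<in> ?Y" if "v \<in> V" for v
    by (rule derivative_into_subspace[OF D subspace_span _ tan[unfolded y0_def] that]) (auto simp: inv intro: span_base)
  have vals: "G y - G y0 \<in> ?Y" if "y \<in> half_space V \<nu> \<inter> O1" for y
    using hO[of y] that Gq Gp W by (auto intro!: span_diff[OF span_base span_base])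
  obtain O' Q F H where O': "open O'" "O' \<subseteq> O1" "y0 \<in> O'" "open Q" "homeomorphism O' Q F H"
    and CF: "\<And>k. Ck_on k O' F" and CH: "\<And>k. Ck_on k Q H"
    and Fh: "\<And>y. y \<in> O' \<Longrightarrow> F y \<in> half_space V \<nu> \<longleftrightarrow> y \<in> half_space V \<nu>"
    and Fk: "\<And>y. y \<in> half_space V \<nu> \<inter> O' \<Longrightarrow> DG (F y) = 0 \<longleftrightarrow> G y = G y0"
  proof (rule straighten_submersion[OF dG, of V \<nu> O1 ?Y])
    show "DG ` V \<subseteq> ?Y" using DGD DY by auto
    show "?Y \<subseteq> DG ` (V \<inter> {v. v \<bullet> \<nu> = 0})"
      using onto DGD by force
    show "Ck_on k O1 G" for k by (rule Ck_on_subset[OF G(3)]) (auto simp: O1_def)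
  qed (use V O1 vals in \<open>auto simp: y0_def\<close>)
  have FH: "H (F y) = y" "F y \<in> Q" if "y \<in> O'" for y using O'(5) that by (auto simp: homeomorphism_def)
  have HF: "F (H z) = z" "H z \<in> O'" if "z \<in> Q" for z using O'(5) that by (auto simp: homeomorphism_def)
  define S where "S = {q \<in> points M. f q = f p}"
  define W1 where "W1 = {q \<in> U. f q = f p \<and> \<phi> q \<in> O'}"
  define \<psi>1 where "\<psi>1 = F \<circ> \<phi>"
  define K where "K = {v \<in> V. DG v = 0}"
  have K: "subspace K"
    using V(1) by (auto simp: K_def subspace_def linear_add[OF lin] linear_scale[OF lin] linear_0[OF lin])
  have "DG ` V = D ` V" using DGD by (intro image_cong) auto
  moreover have "D ` V = ?Y" using onto DY by blast
  ultimately have "DG ` V = ?Y" by simp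
  then have dimK: "dim K = mdim M - mdim N"
    using dim_kernel_plus_dim_image[OF lin V(1)] V(2) chart_dim[OF cW W(2)] by (simp add: K_def)
  have im: "\<psi>1 ` W1 = half_space K \<nu> \<inter> Q"
  proof
    show "\<psi>1 ` W1 \<subseteq> half_space K \<nu> \<inter> Q"
    proof
      fix z assume "z \<in> \<psi>1 ` W1"
      then obtain q where q: "q \<in> U" "f q = f p" "\<phi> q \<in> O'" "z = F (\<phi> q)" by (auto simp: W1_def \<psi>1_def)
      have "\<phi> q \<in> \<phi> ` {q \<in> U. f q \<in> W} \<inter> N1" using q W O' by (auto simp: O1_def)
      then have h: "\<phi> q \<in> half_space V \<nu> \<inter> O'" using N1(3) q by auto
      have "G (\<phi> q) = G y0" using Gq[of q] q W O' Gp by auto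
      with h have "DG z = 0" "z \<in> half_space V \<nu>" using Fk[OF h] Fh[of "\<phi> q"] q by auto
      then show "z \<in> half_space K \<nu> \<inter> Q" using FH(2) q by (auto simp: half_space_def K_def)
    qed
    show "half_space K \<nu> \<inter> Q \<subseteq> \<psi>1 ` W1"
    proof
      fix z assume z: "z \<in> half_space K \<nu> \<inter> Q"
      then have zV: "z \<in> half_space V \<nu>" "DG z = 0" "z \<in> Q" by (auto simp: half_space_def K_def)
      have Hz: "H z \<in> half_space V \<nu>" "H z \<in> O'" using zV HF Fh[of "H z"] by auto
      then obtain q where q: "q \<in> U" "f q \<in> W" "H z = \<phi> q" using hO O' by blast
      have "G (H z) = G y0" using Fk[of "H z"] Hz HF zV by auto
      then have "\<psi> (f q) = \<psi> (f p)" using Gq[of q] q Hz O' Gp by auto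
      then have "f q = f p" using chart_inj_on[OF cW] q W by (auto dest: inj_onD)
      then have "q \<in> W1" using q Hz by (auto simp: W1_def)
      moreover have "\<psi>1 q = z" using HF(1)[OF zV(3)] by (simp add: \<psi>1_def q(3))
      ultimately show "z \<in> \<psi>1 ` W1" by blast
    qed
  qed
  have W1U: "W1 \<subseteq> U" "W1 \<subseteq> S" "W1 \<subseteq> points M"
    using chart_subset[OF cU] by (auto simp: W1_def S_def)
  let ?T = "subtopology (mtop M) S"
  have sub1: "subtopology ?T W1 = subtopology (mtop M) W1"
    using W1U by (simp add: subtopology_subtopology Int_absorb1)
  have top1: "topspace (subtopology (mtop M) W1) = W1" using W1U by auto
  have oW1: "openin ?T W1"
  proof -
    have "W1 = S \<inter> {q \<in> U. \<phi> q \<in> O'}" using W1U by (auto simp: W1_def S_def)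
    then show ?thesis using chart_openin_preimage[OF cU O'(1)] openin_subtopology_Int2 by metis
  qed
  have invW1: "inv_into U \<phi> (H (\<psi>1 q)) = q" if "q \<in> W1" for q
    using that FH(1) by (auto simp: W1_def \<psi>1_def inv)
  have homeo: "homeomorphic_maps (subtopology ?T W1) (top_of_set (\<psi>1 ` W1)) \<psi>1 (\<lambda>z. inv_into U \<phi> (H z))"
    unfolding homeomorphic_maps_def sub1 top1
  proof (intro conjI ballI)
    have "continuous_map (subtopology (mtop M) W1) (top_of_set O') \<phi>"
      using continuous_map_from_subtopology_mono[OF chart_continuous[OF cU] W1U(1)] top1
      by (auto simp: continuous_map_in_subtopology W1_def)
    moreover have "continuous_map (top_of_set O') euclidean F"
      using O'(5) by (auto simp: homeomorphism_def)
    ultimately have "continuous_map (subtopology (mtop M) W1) euclidean \<psi>1"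
      unfolding \<psi>1_def by (rule continuous_map_compose)
    then show "continuous_map (subtopology (mtop M) W1) (top_of_set (\<psi>1 ` W1)) \<psi>1"
      using top1 by (auto simp: continuous_map_in_subtopology)
    have "continuous_on (\<psi>1 ` W1) H"
      using O'(5) im continuous_on_subset unfolding homeomorphism_def by (metis inf_le2)
    moreover have "H ` \<psi>1 ` W1 \<subseteq> \<phi> ` U" using FH(1) by (auto simp: W1_def \<psi>1_def)
    ultimately have "continuous_map (top_of_set (\<psi>1 ` W1)) (top_of_set (\<phi> ` U)) H"
      by (auto simp: continuous_map_in_subtopology)
    from continuous_map_compose[OF this chart_inverse_continuous[OF cU]]
    have "continuous_map (top_of_set (\<psi>1 ` W1)) (subtopology (mtop M) U) (\<lambda>z. inv_into U \<phi> (H z))"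
      by (simp add: o_def)
    then have "continuous_map (top_of_set (\<psi>1 ` W1)) (mtop M) (\<lambda>z. inv_into U \<phi> (H z))"
      by (auto simp: continuous_map_in_subtopology)
    then show "continuous_map (top_of_set (\<psi>1 ` W1)) (subtopology (mtop M) W1) (\<lambda>z. inv_into U \<phi> (H z))"
      using invW1 by (auto simp: continuous_map_in_subtopology)
  qed (use invW1 in auto)
  have half1: "\<exists>\<nu>'\<in>K. openin (top_of_set (half_space K \<nu>')) (\<psi>1 ` W1)"
  proof -
    \<comment> \<open>On \<open>K\<close> the normal \<open>\<nu>\<close> may be replaced by its
    projection to \<open>K\<close>, as a chart requires the normal to lie in the subspace of its
    coordinates.\<close>
    obtain y z where yz: "y \<in> span K" "\<And>w. w \<in> span K \<Longrightarrow> orthogonal z w" "\<nu> = y + z"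
      using orthogonal_subspace_decomp_exists[of K \<nu>] by blast
    have "v \<bullet> z = 0" if "v \<in> K" for v
      using yz(2)[OF span_base[OF that]] by (simp add: orthogonal_def inner_commute)
    then have "half_space K \<nu> = half_space K y"
      by (auto simp: half_space_def yz(3) inner_add_right)
    moreover have "y \<in> K" using yz(1) K by (simp add: span_eq_iff[THEN iffD2])
    ultimately show ?thesis unfolding im using O'(4) by (auto simp: openin_open)
  qed
  then obtain \<nu>' where \<nu>': "\<nu>' \<in> K" "openin (top_of_set (half_space K \<nu>')) (\<psi>1 ` W1)" by blast
  have chart1: "chart ?T (mdim M - mdim N) W1 \<psi>1"
    unfolding chart_def using oW1 homeo homeomorphic_map_maps K dimK \<nu>' by blast
  have pW1: "p \<in> W1" using U O' by (auto simp: W1_def y0_def)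
  have spK: "span (\<psi>1 ` W1) = K"
    using open_in_half_space_tangential(2)[OF K \<nu>'(2)] pW1 by blast
  let ?L = "\<lparr> mtop = subtopology (mtop M) W1, mdim = mdim M - mdim N, atlas = {(W1, \<psi>1)} \<rparr>"
  have inv1: "inv_into W1 \<psi>1 (\<psi>1 q) = q" if "q \<in> W1" for q
    using that chart_inj_on[OF chart1] by simp
  have smooth1: "smooth_on (\<psi>1 ` {x \<in> W1. x \<in> U'}) (\<phi>' \<circ> (\<lambda>x. x) \<circ> inv_into W1 \<psi>1)"
    if U': "(U', \<phi>') \<in> atlas M" for U' \<phi>'
  proof -
    have "smooth_on (\<psi>1 ` {x \<in> W1. x \<in> U'}) (\<lambda>z. (\<phi>' \<circ> inv_into U \<phi>) (H z))"
    proof (rule smooth_on_compose[OF _ smooth_atlas_transition[OF aM U(1) U']])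
      show "smooth_on (\<psi>1 ` {x \<in> W1. x \<in> U'}) H"
        by (rule smooth_onI_Ck[OF O'(4) CH]) (use im in auto)
    qed (use FH(1) in \<open>auto simp: W1_def \<psi>1_def\<close>)
    then show ?thesis by (rule smooth_on_cong) (auto simp: inv1 invW1)
  qed
  have "immersion ?L M (\<lambda>x. x)"
    unfolding immersion_def
  proof (intro conjI ballI)
    show "smooth_map ?L M (\<lambda>x. x)"
      unfolding smooth_map_on_def
      by (auto simp: subtopology_subtopology continuous_map_from_subtopology
          intro!: smooth_on_subset[OF smooth1])
    fix q assume "q \<in> points ?L"
    then have q: "q \<in> W1" by (auto simp: W1U)
    then have qU: "q \<in> U" using W1U by auto
    have c1: "chart_at ?L q = (W1, \<psi>1)" using chart_at_in(1)[of W1 \<psi>1 ?L q] q by simp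
    obtain U' \<phi>' where c2: "chart_at M q = (U', \<phi>')" by fastforce
    have U': "(U', \<phi>') \<in> atlas M" "q \<in> U'" using chart_at_in[OF U(1) qU] c2 by auto
    note cU' = smooth_atlas_chart[OF aM U'(1)]
    have inv': "inv_into U' \<phi>' (\<phi>' x) = x" if "x \<in> U'" for x using that chart_inj_on[OF cU'] by simp
    let ?A = "\<psi>1 ` {x \<in> W1. x \<in> U'}" and ?B = "\<phi>' ` {x \<in> U' \<inter> U. \<phi> x \<in> O'}"
    define J where "J = frechet_derivative (\<phi>' \<circ> (\<lambda>x. x) \<circ> inv_into W1 \<psi>1) (at (\<psi>1 q) within ?A)"
    have J: "((\<phi>' \<circ> (\<lambda>x. x) \<circ> inv_into W1 \<psi>1) has_derivative J) (at (\<psi>1 q) within ?A)"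
      unfolding J_def by (rule smooth_on_has_derivative[OF smooth1[OF U'(1)]]) (use q U' in auto)
    \<comment> \<open>In coordinates the straightening map is a smooth left inverse of the
    inclusion.\<close>
    have "smooth_on ?B (\<lambda>z. F ((\<phi> \<circ> inv_into U' \<phi>') z))"
    proof (rule smooth_on_compose[where g=F and R=O'])
      show "smooth_on ?B (\<phi> \<circ> inv_into U' \<phi>')"
        by (rule smooth_on_subset[OF smooth_atlas_transition[OF aM U'(1) U(1)]]) auto
      show "smooth_on O' F" by (rule smooth_onI_Ck[OF O'(1) CF]) auto
    qed (auto simp: inv')
    moreover have pt: "(\<phi>' \<circ> (\<lambda>x. x) \<circ> inv_into W1 \<psi>1) (\<psi>1 q) = \<phi>' q" using q by (simp add: inv1)
    ultimately obtain I where I: "((\<lambda>z. F ((\<phi> \<circ> inv_into U' \<phi>') z)) has_derivative I)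
        (at ((\<phi>' \<circ> (\<lambda>x. x) \<circ> inv_into W1 \<psi>1) (\<psi>1 q)) within ?B)"
      using smooth_on_has_derivative[of ?B _ "\<phi>' q"] q U' W1U by (fastforce simp: W1_def)
    have tan1: "tangential ?A (\<psi>1 q) K"
      unfolding spK[symmetric]
    proof (rule chart_tangential[OF chart1])
      have "{x \<in> W1. x \<in> U'} = W1 \<inter> (S \<inter> U')" using W1U by auto
      then show "openin ?T {x \<in> W1. x \<in> U'}"
        using oW1 chart_openin[OF cU'] by (metis openin_Int openin_subtopology_Int2)
    qed (use q U' in auto)
    have W1D: "x \<in> U" "\<phi> x \<in> O'" "F (\<phi> x) = \<psi>1 x" if "x \<in> W1" for x
      using that by (auto simp: W1_def \<psi>1_def)
    have IJ: "I (J v) = v" if "v \<in> K" for v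
      by (rule derivative_left_inverse_tangential[OF J I _ _ tan1 that, where a=0])
        (auto simp: inv1 inv' W1D)
    have "inj_on J (span K)"
      by (rule inj_on_inverseI[of _ I]) (use IJ K in \<open>simp add: span_eq_iff[THEN iffD2]\<close>)
    then have "dim (J ` K) = dim K" using J has_derivative_linear by (intro dim_image_eq) auto
    then show "diff_rank ?L M (\<lambda>x. x) q = mdim ?L"
      by (simp add: diff_rank_def c1 c2 spK J_def dimK)
  qed
  with chart1 have "(W1, \<psi>1) \<in> atlas (submanifold M (mdim M - mdim N) S)"
    by (simp add: submanifold_def)
  then show ?thesis using pW1 unfolding S_def by blast
qed

section \<open>Lifting derivatives and openness of injectivity\<close>

text \<open>A continuous map into the source of an immersion \<open>h\<close> is differentiable as
soon as its composition with \<open>h\<close> is. With a left inverse \<open>L\<close> of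
\<open>J\<close>, the map \<open>L \<circ> h\<close> agrees with the identity up to an error
\<open>o(\<bar>f z - f x\<bar>)\<close>. With half of the distance as the error bound this shows
that \<open>f z - f x\<close> is \<open>O(\<bar>z - x\<bar>)\<close>; hence the error is
\<open>o(\<bar>z - x\<bar>)\<close> and \<open>L \<circ> D\<close> is the derivative of
\<open>f\<close>.\<close>

lemma has_derivative_lift:
  fixes f :: "'a::real_normed_vector \<Rightarrow> 'b::euclidean_space" and h :: "'b \<Rightarrow> 'c::euclidean_space"
  assumes h: "(h has_derivative J) (at (f x) within B)" and K: "subspace K" "B \<subseteq> K"
    and inj: "\<And>v. v \<in> K \<Longrightarrow> J v = 0 \<Longrightarrow> v = 0"
    and f: "f ` A \<subseteq> B" "x \<in> A" "continuous (at x within A) f"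
    and hf: "((\<lambda>z. h (f z)) has_derivative D) (at x within A)"
  shows "\<exists>f'. (f has_derivative f') (at x within A)"
proof -
  have linJ: "linear J" using h by (rule has_derivative_linear)
  have "inj_on J K"
    using inj linear_injective_on_subspace_0[OF linJ K(1)] by blast
  then obtain L where L: "linear L" "\<And>v. v \<in> K \<Longrightarrow> L (J v) = v"
    using linear_exists_left_inverse_on[OF linJ K(1)] by metis
  then have bL: "bounded_linear L" by (simp add: linear_conv_bounded_linear)
  have Lh: "((\<lambda>y. L (h y)) has_derivative (\<lambda>v. L (J v))) (at (f x) within B)"
    by (rule bounded_linear.has_derivative[OF bL h])
  have Lhf: "((\<lambda>z. L (h (f z))) has_derivative (\<lambda>v. L (D v))) (at x within A)"
    by (rule bounded_linear.has_derivative[OF bL hf])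
  obtain c where c: "c > 0" "\<And>v. norm (L (D v)) \<le> norm v * c"
    using bounded_linear.pos_bounded[OF has_derivative_bounded_linear[OF Lhf]] by auto
  have rem: "\<exists>d>0. \<forall>z\<in>A. norm (z - x) < d \<longrightarrow>
      norm (L (h (f z)) - L (h (f x)) - (f z - f x)) \<le> e * norm (f z - f x)" if "e > 0" for e
  proof -
    from conjunct2[OF Lh[unfolded has_derivative_within_alt], rule_format, OF that]
    obtain d where d: "d > 0" "\<forall>y\<in>B. norm (y - f x) < d \<longrightarrow>
        norm (L (h y) - L (h (f x)) - L (J (y - f x))) \<le> e * norm (y - f x)" by blast
    from f(3)[unfolded continuous_within_eps_delta dist_norm, rule_format, OF d(1)]
    obtain d' where d': "d' > 0" "\<forall>z\<in>A. norm (z - x) < d' \<longrightarrow> norm (f z - f x) < d" by blast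
    have LJ: "L (J (f z - f x)) = f z - f x" if "z \<in> A" for z
      using that f K by (intro L(2) subspace_diff) auto
    have "norm (L (h (f z)) - L (h (f x)) - (f z - f x)) \<le> e * norm (f z - f x)"
      if "z \<in> A" "norm (z - x) < d'" for z
    proof -
      have "f z \<in> B" "norm (f z - f x) < d" using that f(1) d' by auto
      then show ?thesis using d(2) LJ[OF that(1)] by metis
    qed
    with d' show ?thesis by blast
  qed
  have "(f has_derivative (\<lambda>v. L (D v))) (at x within A)"
    unfolding has_derivative_within_alt
  proof (intro conjI allI impI)
    show "bounded_linear (\<lambda>v. L (D v))" by (rule has_derivative_bounded_linear[OF Lhf])
    fix e :: real assume e: "e > 0"
    \<comment> \<open>Since \<open>\<bar>f z - f x\<bar> \<le> 2 (c + 1) \<bar>z - x\<bar>\<close>,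
    the immersion contributes at most \<open>e / 2\<close>.\<close>
    define e1 where "e1 = e / (4 * (c + 1))"
    have e1: "e1 > 0" "2 * (c + 1) * e1 = e / 2" using e c by (auto simp: e1_def field_simps)
    obtain d1 where d1: "d1 > 0" "\<forall>z\<in>A. norm (z - x) < d1 \<longrightarrow>
        norm (L (h (f z)) - L (h (f x)) - (f z - f x)) \<le> 1/2 * norm (f z - f x)"
      using rem[of "1/2"] by auto
    obtain d2 where d2: "d2 > 0" "\<forall>z\<in>A. norm (z - x) < d2 \<longrightarrow>
        norm (L (h (f z)) - L (h (f x)) - (f z - f x)) \<le> e1 * norm (f z - f x)"
      using rem[OF e1(1)] by blast
    note Lhf' = conjunct2[OF Lhf[unfolded has_derivative_within_alt], rule_format]
    from Lhf'[OF zero_less_one]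
    obtain d3 where d3: "d3 > 0" "\<forall>z\<in>A. norm (z - x) < d3 \<longrightarrow>
        norm (L (h (f z)) - L (h (f x)) - L (D (z - x))) \<le> 1 * norm (z - x)" by blast
    have "e / 2 > 0" using e by simp
    from Lhf'[OF this]
    obtain d4 where d4: "d4 > 0" "\<forall>z\<in>A. norm (z - x) < d4 \<longrightarrow>
        norm (L (h (f z)) - L (h (f x)) - L (D (z - x))) \<le> e / 2 * norm (z - x)" by blast
    show "\<exists>d>0. \<forall>z\<in>A. norm (z - x) < d \<longrightarrow> norm (f z - f x - L (D (z - x))) \<le> e * norm (z - x)"
    proof (intro exI[of _ "min (min d1 d2) (min d3 d4)"] conjI ballI impI)
      fix z assume z: "z \<in> A" "norm (z - x) < min (min d1 d2) (min d3 d4)"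
      let ?a = "f z - f x" and ?b = "L (h (f z)) - L (h (f x))"
      have "norm ?b \<le> norm (L (D (z - x))) + norm (?b - L (D (z - x)))" by (rule norm_triangle_sub)
      also have "\<dots> \<le> (c + 1) * norm (z - x)"
        using c(2)[of "z - x"] bspec[OF d3(2) z(1)] z(2) by (simp add: algebra_simps)
      finally have b: "norm ?b \<le> (c + 1) * norm (z - x)" .
      have "norm ?a \<le> norm ?b + norm (?a - ?b)" by (rule norm_triangle_sub)
      also have "norm (?a - ?b) \<le> 1/2 * norm ?a"
        using bspec[OF d1(2) z(1)] z(2) by (simp add: norm_minus_commute)
      finally have a: "norm ?a \<le> 2 * (c + 1) * norm (z - x)" using b by linarith
      have "norm (?a - L (D (z - x))) \<le> norm (?a - ?b) + norm (?b - L (D (z - x)))"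
        using norm_triangle_ineq[of "?a - ?b" "?b - L (D (z - x))"] by simp
      also have "norm (?a - ?b) \<le> e1 * norm ?a"
        using bspec[OF d2(2) z(1)] z(2) by (simp add: norm_minus_commute)
      also have "e1 * norm ?a \<le> e1 * (2 * (c + 1) * norm (z - x))" using a e1 by (intro mult_left_mono) auto
      also have "\<dots> = e / 2 * norm (z - x)" using e1(2) by (metis mult.assoc mult.commute)
      also have "norm (?b - L (D (z - x))) \<le> e / 2 * norm (z - x)" using bspec[OF d4(2) z(1)] z(2) by simp
      finally show "norm (?a - L (D (z - x))) \<le> e * norm (z - x)" by simp
    qed (use d1 d2 d3 d4 in auto)
  qed
  then show ?thesis by blast
qed

text \<open>An injective map \<open>B0\<close> has a left inverse \<open>L\<close>, and a map
\<open>B\<close> with \<open>\<bar>B - B0\<bar> \<bar>L\<bar> < 1\<close> cannot annihilate a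
nonzero vector of \<open>V\<close>.\<close>

lemma open_injective_on_subspace:
  fixes A :: "'z::t2_space \<Rightarrow> 'a::euclidean_space \<Rightarrow> 'b::euclidean_space"
  assumes Om: "open Om" and A: "\<And>z. z \<in> Om \<Longrightarrow> linear (A z)" "\<And>v. continuous_on Om (\<lambda>z. A z v)"
    and V: "subspace V"
  shows "open {z \<in> Om. \<forall>v\<in>V. A z v = 0 \<longrightarrow> v = 0}"
proof -
  define S where "S = {B :: 'a \<Rightarrow>\<^sub>L 'b. \<forall>v\<in>V. blinfun_apply B v = 0 \<longrightarrow> v = 0}"
  have "open S"
    unfolding open_dist
  proof
    fix B0 assume B0: "B0 \<in> S"
    have lin: "linear (blinfun_apply B0)" by (rule bounded_linear.linear[OF blinfun.bounded_linear_right])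
    have "inj_on (blinfun_apply B0) V"
      using B0 linear_injective_on_subspace_0[OF lin V] by (auto simp: S_def)
    then obtain L where L: "linear L" "\<And>v. v \<in> V \<Longrightarrow> L (blinfun_apply B0 v) = v"
      using linear_exists_left_inverse_on[OF lin V] by metis
    obtain c where c: "c > 0" "\<And>w. norm (L w) \<le> norm w * c"
      using bounded_linear.pos_bounded L(1) linear_conv_bounded_linear by metis
    have "B \<in> S" if B: "dist B B0 < 1 / c" for B
      unfolding S_def
    proof (intro CollectI ballI impI)
      fix v assume v: "v \<in> V" "blinfun_apply B v = 0"
      have "norm v = norm (L (blinfun_apply (B0 - B) v))" using v L(2) by (simp add: blinfun.diff_left)
      also have "\<dots> \<le> norm (blinfun_apply (B0 - B) v) * c" by (rule c)
      also have "\<dots> \<le> (norm (B0 - B) * norm v) * c"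
        using c by (intro mult_right_mono norm_blinfun) auto
      finally have le: "norm v \<le> (norm (B0 - B) * c) * norm v" by (simp add: mult_ac)
      have "norm (B0 - B) * c < 1" using B c by (simp add: dist_norm norm_minus_commute field_simps)
      show "v = 0"
      proof (rule ccontr)
        assume "v \<noteq> 0"
        then have "(norm (B0 - B) * c) * norm v < 1 * norm v"
          using \<open>norm (B0 - B) * c < 1\<close> by (intro mult_strict_right_mono) auto
        with le show False by simp
      qed
    qed
    then show "\<exists>e>0. \<forall>B. dist B B0 < e \<longrightarrow> B \<in> S" using c by (intro exI[of _ "1 / c"]) auto
  qed
  have app: "blinfun_apply (Blinfun (A z)) = A z" if "z \<in> Om" for z
    using A(1)[OF that] by (intro bounded_linear_Blinfun_apply) (simp add: linear_conv_bounded_linear)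
  have "continuous_on Om (\<lambda>z. Blinfun (A z))"
    by (rule continuous_on_blinfun_componentwise) (use A(2) app in \<open>simp cong: continuous_on_cong\<close>)
  then have "open (Om \<inter> (\<lambda>z. Blinfun (A z)) -` S)"
    using Om \<open>open S\<close> by (rule continuous_open_preimage)
  also have "Om \<inter> (\<lambda>z. Blinfun (A z)) -` S = {z \<in> Om. \<forall>v\<in>V. A z v = 0 \<longrightarrow> v = 0}"
    using app by (auto simp: S_def)
  finally show ?thesis .
qed

lemma dim_image_eq_dim_iff:
  fixes D :: "'a::euclidean_space \<Rightarrow> 'b::euclidean_space"
  assumes "linear D" "subspace V"
  shows "dim (D ` V) = dim V \<longleftrightarrow> (\<forall>v\<in>V. D v = 0 \<longrightarrow> v = 0)"
proof -
  have "dim (D ` V) = dim V \<longleftrightarrow> dim {v \<in> V. D v = 0} = 0"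
    using dim_kernel_plus_dim_image[OF assms] by linarith
  also have "\<dots> \<longleftrightarrow> (\<forall>v\<in>V. D v = 0 \<longrightarrow> v = 0)" by auto
  finally show ?thesis .
qed

text \<open>The definition of \<^const>\<open>submanifold\<close> states the rank of the inclusion
only in the chosen charts of \<open>M\<close>; by chart independence the inclusion has an
injective derivative in all of them.\<close>

lemma submanifold_chart_derivative:
  assumes M: "smooth_manifold M" and W: "(W, \<psi>) \<in> atlas (submanifold M k S)" "p \<in> W"
    and U: "(U, \<phi>) \<in> atlas M" "p \<in> U"
  obtains J where "((\<phi> \<circ> inv_into W \<psi>) has_derivative J) (at (\<psi> p) within \<psi> ` (W \<inter> U))"
    "\<forall>v\<in>span (\<psi> ` W). J v = 0 \<longrightarrow> v = 0" "J ` span (\<psi> ` W) \<subseteq> span (\<phi> ` U)"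
proof -
  note aM = smooth_manifold_atlas[OF M]
  let ?L = "\<lparr> mtop = subtopology (mtop M) W, mdim = k, atlas = {(W, \<psi>)} \<rparr>"
  have c: "chart (subtopology (mtop M) S) k W \<psi>" and im: "immersion ?L M (\<lambda>x. x)"
    using W(1) by (auto simp: submanifold_def)
  have WS: "W \<subseteq> S" "W \<subseteq> points M" using chart_subset[OF c] by auto
  have inv: "inv_into W \<psi> (\<psi> q) = q" if "q \<in> W" for q using that chart_inj_on[OF c] by simp
  have sub: "subtopology (subtopology (mtop M) S) W = subtopology (mtop M) W"
    using WS by (simp add: subtopology_subtopology Int_absorb1)
  have c': "chart (subtopology (mtop M) W) k W \<psi>"
  proof -
    have "subtopology (subtopology (mtop M) W) W = subtopology (mtop M) W"
      by (simp add: subtopology_subtopology)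
    moreover have "openin (subtopology (mtop M) W) W" using WS(2) by (metis openin_topspace topspace_subtopology_subset)
    ultimately show ?thesis using c unfolding chart_def sub by auto
  qed
  have aL: "smooth_atlas ?L"
  proof -
    have "smooth_on (\<psi> ` (W \<inter> W)) (\<lambda>x. x)"
      by (rule smooth_onI_Ck[of UNIV]) (auto simp: Ck_on_id)
    then have "smooth_on (\<psi> ` (W \<inter> W)) (\<psi> \<circ> inv_into W \<psi>)"
      by (rule smooth_on_cong) (auto simp: inv)
    with c' show ?thesis by (simp add: smooth_atlas_def)
  qed
  have sm: "smooth_map ?L M (\<lambda>x. x)" using im by (simp add: immersion_def)
  define J where "J = frechet_derivative (\<phi> \<circ> (\<lambda>x. x) \<circ> inv_into W \<psi>) (at (\<psi> p) within \<psi> ` {x \<in> W. x \<in> U})"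
  have J: "((\<phi> \<circ> (\<lambda>x. x) \<circ> inv_into W \<psi>) has_derivative J) (at (\<psi> p) within \<psi> ` {x \<in> W. x \<in> U})"
    unfolding J_def by (rule smooth_on_has_derivative[OF smooth_map_smooth_on[OF sm aL _ U(1)]]) (use W U in auto)
  have "dim (J ` span (\<psi> ` W)) = diff_rank ?L M (\<lambda>x. x) p"
    using diff_rank_chart[OF aL aM sm _ W(2) U] by (simp add: chart_rank_def J_def)
  also have "\<dots> = k" using im W WS by (auto simp: immersion_def)
  also have "\<dots> = dim (span (\<psi> ` W))" using chart_dim[OF c W(2)] by simp
  finally have 1: "\<forall>v\<in>span (\<psi> ` W). J v = 0 \<longrightarrow> v = 0"
    using dim_image_eq_dim_iff[OF has_derivative_linear[OF J] subspace_span] by blast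
  have eqs: "\<phi> \<circ> (\<lambda>x. x) \<circ> inv_into W \<psi> = \<phi> \<circ> inv_into W \<psi>" "{x \<in> W. x \<in> U} = W \<inter> U" by auto
  have J': "((\<phi> \<circ> inv_into W \<psi>) has_derivative J) (at (\<psi> p) within \<psi> ` (W \<inter> U))"
    using J unfolding eqs .
  have tan: "tangential (\<psi> ` (W \<inter> U)) (\<psi> p) (span (\<psi> ` W))"
    by (rule chart_tangential[OF c'])
      (use W U chart_openin[OF smooth_atlas_chart[OF aM U(1)]] in \<open>auto intro: openin_subtopology_Int2\<close>)
  have "J v \<in> span (\<phi> ` U)" if "v \<in> span (\<psi> ` W)" for v
    by (rule derivative_into_subspace[OF J' subspace_span _ tan that]) (auto simp: inv intro: span_base)
  then have "J ` span (\<psi> ` W) \<subseteq> span (\<phi> ` U)" by blast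
  with J' 1 show thesis by (rule that)
qed

lemma inv_into_map_prod:
  assumes "inj_on f A" "inj_on g B" "a \<in> A" "b \<in> B"
  shows "inv_into (A \<times> B) (map_prod f g) (f a, g b) = (a, b)"
proof -
  have "inv_into (A \<times> B) (map_prod f g) (map_prod f g (a, b)) = (a, b)"
    using assms by (intro inv_into_f_f map_prod_inj_on) auto
  then show ?thesis by simp
qed

section \<open>Translations in a Lie category\<close>

context lie_category
begin

lemma target_fibre_chart_at:
  assumes p: "p \<in> points C" "t p = x"
  obtains W \<psi> where "chart_at (target_fibre x) p = (W, \<psi>)"
    "(W, \<psi>) \<in> atlas (submanifold C (mdim C - mdim X) {h \<in> points C. t h = x})" "p \<in> W"
proof -
  obtain W0 \<psi>0 where W0: "(W0, \<psi>0) \<in> atlas (target_fibre x)" "p \<in> W0"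
    using fibre_chart_exists[OF arrows_manifold objects_manifold target_submersion
        target_boundary_submersion p(1)] unfolding target_fibre_def p(2) by blast
  obtain W \<psi> where W: "chart_at (target_fibre x) p = (W, \<psi>)" by fastforce
  show thesis using chart_at_in[OF W0] W by (intro that) (auto simp: target_fibre_def)
qed

lemma left_translation_continuous:
  assumes g: "g \<in> points C"
  shows "continuous_map (subtopology (mtop C) {h \<in> points C. t h = s g}) (mtop C) (m g)"
proof -
  let ?F = "subtopology (mtop C) {h \<in> points C. t h = s g}"
  let ?P = "{(g, h). g \<in> points C \<and> h \<in> points C \<and> s g = t h}"
  have "continuous_map ?F (prod_topology (mtop C) (mtop C)) (\<lambda>h. (g, h))"
    using g by (auto intro!: continuous_map_pairedI simp: continuous_map_from_subtopology)
  then have "continuous_map ?F (subtopology (prod_topology (mtop C) (mtop C)) ?P) (\<lambda>h. (g, h))"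
    using g by (auto simp: continuous_map_in_subtopology)
  moreover have "continuous_map (subtopology (prod_topology (mtop C) (mtop C)) ?P) (mtop C) (\<lambda>(g, h). m g h)"
    using comp_smooth by (simp add: smooth_map_on_def product_manifold_def)
  ultimately have "continuous_map ?F (mtop C) ((\<lambda>(g, h). m g h) \<circ> (\<lambda>h. (g, h)))"
    by (rule continuous_map_compose)
  then show ?thesis by (simp add: o_def)
qed

text \<open>Full rank expressed on the whole tangent space at the unit, in fixed charts. Here
\<open>G\<close> is the target map and \<open>Mu\<close> the composition, both extended to open
sets of coordinates. The tangent space of the fibre, included by \<open>J1\<close>, is the kernel
of \<open>DG\<close>: it is contained in the kernel since the target is constant on the fibre, and
the dimensions agree since the target is a submersion. On it the differential of the left
translation, followed by the injective \<open>J2\<close>, is \<open>v \<mapsto> DM (0, v)\<close>.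
So full rank means that no nonzero vector is annihilated by both \<open>DG\<close> and \<open>DM
(0, _)\<close>.\<close>

lemma left_rank_full_iff:
  assumes g: "g \<in> points C" and U: "(U, \<phi>) \<in> atlas C" "g \<in> U"
    and U1: "(U1, \<phi>1) \<in> atlas C" "u (s g) \<in> U1" and W: "(W, \<psi>) \<in> atlas X" "s g \<in> W"
    and N1: "open N1" "\<phi>1 (u (s g)) \<in> N1" and G: "(G has_derivative DG) (at (\<phi>1 (u (s g))))"
    and GT: "\<And>q. q \<in> U1 \<Longrightarrow> t q \<in> W \<Longrightarrow> \<phi>1 q \<in> N1 \<Longrightarrow> G (\<phi>1 q) = \<psi> (t q)"
    and N2: "open N2" "(\<phi> g, \<phi>1 (u (s g))) \<in> N2" and Mu: "(Mu has_derivative DM) (at (\<phi> g, \<phi>1 (u (s g))))"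
    and MuT: "\<And>h. h \<in> U1 \<Longrightarrow> t h = s g \<Longrightarrow> m g h \<in> U \<Longrightarrow> (\<phi> g, \<phi>1 h) \<in> N2 \<Longrightarrow> Mu (\<phi> g, \<phi>1 h) = \<phi> (m g h)"
  shows "left_rank g = mdim C - mdim X \<longleftrightarrow> (\<forall>v\<in>span (\<phi>1 ` U1). DG v = 0 \<and> DM (0, v) = 0 \<longrightarrow> v = 0)"
proof -
  define k where "k = mdim C - mdim X"
  define e where "e = u (s g)"
  note aC = smooth_manifold_atlas[OF arrows_manifold] and aX = smooth_manifold_atlas[OF objects_manifold]
  note cU = smooth_atlas_chart[OF aC U(1)] and cU1 = smooth_atlas_chart[OF aC U1(1)]
    and cW = smooth_atlas_chart[OF aX W(1)]
  have st: "smooth_map C X t" using target_submersion by (simp add: submersion_def)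
  have e: "e \<in> points C" "t e = s g" "m g e = g" "e \<in> U1" "\<phi>1 e \<in> N1" "(\<phi> g, \<phi>1 e) \<in> N2"
    using g U1 N1 N2 source_in unit_in target_unit unit_right by (auto simp: e_def)
  have inv1: "inv_into U1 \<phi>1 (\<phi>1 q) = q" if "q \<in> U1" for q using that chart_inj_on[OF cU1] by simp
  let ?S1 = "{h \<in> points C. t h = s g}" and ?S2 = "{h \<in> points C. t h = t g}"
  let ?T1 = "subtopology (mtop C) ?S1" and ?T2 = "subtopology (mtop C) ?S2"
  obtain W1 \<psi>1 where W1: "chart_at (target_fibre (s g)) e = (W1, \<psi>1)"
    "(W1, \<psi>1) \<in> atlas (submanifold C k ?S1)" "e \<in> W1"
    using target_fibre_chart_at[OF e(1,2)] unfolding k_def .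
  obtain W2 \<psi>2 where W2: "chart_at (target_fibre (t g)) g = (W2, \<psi>2)"
    "(W2, \<psi>2) \<in> atlas (submanifold C k ?S2)" "g \<in> W2"
    using target_fibre_chart_at[OF g refl] unfolding k_def .
  have c1: "chart ?T1 k W1 \<psi>1" and c2: "chart ?T2 k W2 \<psi>2"
    using W1(2) W2(2) by (auto simp: submanifold_def)
  have W1S: "W1 \<subseteq> ?S1" and W2S: "W2 \<subseteq> ?S2" using chart_subset[OF c1] chart_subset[OF c2] by auto
  have invW1: "inv_into W1 \<psi>1 (\<psi>1 q) = q" if "q \<in> W1" for q using that chart_inj_on[OF c1] by simp
  have invW2: "inv_into W2 \<psi>2 (\<psi>2 q) = q" if "q \<in> W2" for q using that chart_inj_on[OF c2] by simp
  define V1 where "V1 = span (\<phi>1 ` U1)"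
  define K1 where "K1 = span (\<psi>1 ` W1)"
  define K2 where "K2 = span (\<psi>2 ` W2)"
  have sub: "subspace V1" "subspace K1" "subspace K2" by (auto simp: V1_def K1_def K2_def)
  have dims: "dim V1 = mdim C" "dim K1 = k"
    using chart_dim[OF cU1 e(4)] chart_dim[OF c1 W1(3)] by (auto simp: V1_def K1_def)
  obtain J1 where J1: "((\<phi>1 \<circ> inv_into W1 \<psi>1) has_derivative J1) (at (\<psi>1 e) within \<psi>1 ` (W1 \<inter> U1))"
    and J1i: "\<forall>v\<in>K1. J1 v = 0 \<longrightarrow> v = 0" and J1V: "J1 ` K1 \<subseteq> V1"
    using submanifold_chart_derivative[OF arrows_manifold W1(2,3) U1(1) e(4)] unfolding K1_def V1_def .
  obtain J2 where J2: "((\<phi> \<circ> inv_into W2 \<psi>2) has_derivative J2) (at (\<psi>2 g) within \<psi>2 ` (W2 \<inter> U))"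
    and J2i: "\<forall>v\<in>K2. J2 v = 0 \<longrightarrow> v = 0" and "J2 ` K2 \<subseteq> span (\<phi> ` U)"
    using submanifold_chart_derivative[OF arrows_manifold W2(2,3) U] unfolding K2_def .
  have lin: "linear DG" "linear J1" "linear J2"
    using G J1 J2 has_derivative_linear by auto
  have open1: "openin ?T1 (?S1 \<inter> Q)" if "openin (mtop C) Q" for Q
    using that by (rule openin_subtopology_Int2)
  have pe: "(\<phi>1 \<circ> inv_into W1 \<psi>1) (\<psi>1 e) = \<phi>1 e" using W1 by (simp add: invW1)

  have kernel: "J1 ` K1 = {v \<in> V1. DG v = 0}"
  proof -
    define Q where "Q = W1 \<inter> (?S1 \<inter> {q \<in> U1. \<phi>1 q \<in> N1})"
    have Q: "openin ?T1 Q" unfolding Q_def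
      by (intro openin_Int[OF chart_openin[OF c1]] open1 chart_openin_preimage[OF cU1 N1(1)])
    have eQ: "e \<in> Q" using W1 W1S e by (auto simp: Q_def)
    have tan: "tangential (\<psi>1 ` Q) (\<psi>1 e) K1"
      unfolding K1_def by (rule chart_tangential[OF c1 Q _ eQ]) (auto simp: Q_def)
    have 1: "((\<phi>1 \<circ> inv_into W1 \<psi>1) has_derivative J1) (at (\<psi>1 e) within \<psi>1 ` Q)"
      by (rule has_derivative_subset[OF J1]) (auto simp: Q_def)
    have 2: "(G has_derivative DG) (at ((\<phi>1 \<circ> inv_into W1 \<psi>1) (\<psi>1 e)))"
      using G unfolding pe by (simp add: e_def)
    have 3: "((\<lambda>z. G ((\<phi>1 \<circ> inv_into W1 \<psi>1) z)) has_derivative (\<lambda>v. DG (J1 v))) (at (\<psi>1 e) within \<psi>1 ` Q)"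
      by (rule has_derivative_compose[OF 1 2])
    have "DG (J1 v) = 0" if "v \<in> K1" for v
      by (rule derivative_of_constant_tangential[OF 3 _ tan that, of "\<psi> (s g)"])
        (use W W1S GT in \<open>auto simp: Q_def invW1\<close>)
    then have sub1: "J1 ` K1 \<subseteq> {v \<in> V1. DG v = 0}" using J1V by auto
    let ?S = "\<phi>1 ` {q \<in> U1. t q \<in> W}"
    define D where "D = frechet_derivative (\<psi> \<circ> t \<circ> inv_into U1 \<phi>1) (at (\<phi>1 e) within ?S)"
    have D: "((\<psi> \<circ> t \<circ> inv_into U1 \<phi>1) has_derivative D) (at (\<phi>1 e) within ?S)"
      unfolding D_def by (rule smooth_on_has_derivative[OF smooth_map_smooth_on[OF st aC U1(1) W(1)]])
        (use e W in auto)
    have tanS: "tangential ?S (\<phi>1 e) V1"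
      unfolding V1_def by (rule chart_tangential[OF cU1])
        (use e W in \<open>auto intro!: smooth_map_openin[OF st] chart_openin[OF cU1] chart_openin[OF cW]\<close>)
    have "DG v = D v" if "v \<in> V1" for v
    proof (rule derivative_unique_tangential[OF _ _ _ tangential_Int_open[OF tanS N1(1) e(5)] that])
      show "(G has_derivative DG) (at (\<phi>1 e) within ?S \<inter> N1)"
        using G unfolding e_def by (rule has_derivative_at_withinI)
      show "((\<psi> \<circ> t \<circ> inv_into U1 \<phi>1) has_derivative D) (at (\<phi>1 e) within ?S \<inter> N1)"
        by (rule has_derivative_subset[OF D]) auto
    qed (use GT in \<open>auto simp: inv1\<close>)
    then have "DG ` V1 = D ` V1" by (intro image_cong) auto
    moreover have "dim (D ` V1) = mdim X"
    proof -
      have "dim (D ` V1) = diff_rank C X t e"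
        using diff_rank_chart[OF aC aX st U1(1) e(4) W(1)] W(2) e(2) by (simp add: chart_rank_def D_def V1_def)
      then show ?thesis using target_submersion e(1) by (auto simp: submersion_def)
    qed
    ultimately have dimker: "dim {v \<in> V1. DG v = 0} = k"
      using dim_kernel_plus_dim_image[OF lin(1) sub(1)] dims by (simp add: k_def)
    have "dim (J1 ` K1) = dim K1" using dim_image_eq_dim_iff[OF lin(2) sub(2)] J1i by blast
    moreover have "subspace {v \<in> V1. DG v = 0}"
      using sub(1) by (auto simp: subspace_def linear_add[OF lin(1)] linear_scale[OF lin(1)] linear_0[OF lin(1)])
    ultimately show ?thesis
      using sub1 dimker dims linear_subspace_image[OF lin(2) sub(2)] by (intro subspace_dim_equal) auto
  qed

  define R where "R = {h \<in> W1. m g h \<in> W2}"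
  define f where "f = \<psi>2 \<circ> m g \<circ> inv_into W1 \<psi>1"
  define DL where "DL = frechet_derivative f (at (\<psi>1 e) within \<psi>1 ` R)"
  have rank: "left_rank g = dim (DL ` K1)"
    unfolding left_rank_def diff_rank_def using W1(1) W2(1) e(3)
    by (simp add: e_def[symmetric] DL_def f_def R_def K1_def)
  have mS2: "m g h \<in> ?S2" if "h \<in> ?S1" for h using that g comp_in target_comp by auto
  have cont: "continuous_map ?T1 ?T2 (m g)"
    using left_translation_continuous[OF g] mS2 by (auto simp: continuous_map_in_subtopology)
  have openR: "openin ?T1 {h \<in> ?S1. m g h \<in> Q}" if "openin ?T2 Q" for Q
    using openin_continuous_map_preimage[OF cont that] by (auto simp: Int_def conj_ac)
  have contU: "openin ?T1 {h \<in> ?S1. m g h \<in> U}"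
    using openin_continuous_map_preimage[OF left_translation_continuous[OF g] chart_openin[OF cU]]
    by (auto simp: Int_def conj_ac)
  have R: "openin ?T1 R" "R \<subseteq> W1" "e \<in> R"
  proof -
    have "R = W1 \<inter> {h \<in> ?S1. m g h \<in> W2}" using W1S by (auto simp: R_def)
    then show "openin ?T1 R" using openin_Int[OF chart_openin[OF c1] openR[OF chart_openin[OF c2]]] by simp
  qed (use W1 W2 e in \<open>auto simp: R_def\<close>)
  define N3 where "N3 = {y. (\<phi> g, y) \<in> N2}"
  have N3: "open N3"
  proof -
    have "N3 = Pair (\<phi> g) -` N2" by (auto simp: N3_def)
    then show ?thesis using N2(1) by (simp add: open_vimage continuous_on_Pair)
  qed
  define Q where "Q = R \<inter> ({h \<in> ?S1. m g h \<in> U} \<inter> (?S1 \<inter> {q \<in> U1. \<phi>1 q \<in> N3}))"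
  have Q: "openin ?T1 Q" "Q \<subseteq> W1" "e \<in> Q"
  proof -
    show "openin ?T1 Q" unfolding Q_def
      by (intro openin_Int R(1) contU open1 chart_openin_preimage[OF cU1 N3])
  qed (use R e U W1S in \<open>auto simp: Q_def N3_def\<close>)
  have tan: "tangential (\<psi>1 ` Q) (\<psi>1 e) K1"
    unfolding K1_def by (rule chart_tangential[OF c1 Q])
  have fQ: "f (\<psi>1 h) = \<psi>2 (m g h)" if "h \<in> W1" for h using that by (simp add: f_def invW1)
  have J1Q: "((\<phi>1 \<circ> inv_into W1 \<psi>1) has_derivative J1) (at (\<psi>1 e) within \<psi>1 ` Q)"
    by (rule has_derivative_subset[OF J1]) (auto simp: Q_def R_def)
  have pairQ: "((\<lambda>z. (\<phi> g, (\<phi>1 \<circ> inv_into W1 \<psi>1) z)) has_derivative (\<lambda>v. (0, J1 v))) (at (\<psi>1 e) within \<psi>1 ` Q)"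
    by (rule has_derivative_Pair[OF has_derivative_const J1Q])
  have Mu': "(Mu has_derivative DM) (at (\<phi> g, (\<phi>1 \<circ> inv_into W1 \<psi>1) (\<psi>1 e)))"
    using Mu unfolding pe by (simp add: e_def)
  have MuQ: "((\<lambda>z. Mu (\<phi> g, (\<phi>1 \<circ> inv_into W1 \<psi>1) z)) has_derivative (\<lambda>v. DM (0, J1 v))) (at (\<psi>1 e) within \<psi>1 ` Q)"
    by (rule has_derivative_compose[OF pairQ Mu'])
  have fe: "f (\<psi>1 e) = \<psi>2 g" using fQ[OF W1(3)] e by simp
  have hf_eq: "Mu (\<phi> g, (\<phi>1 \<circ> inv_into W1 \<psi>1) z) = (\<phi> \<circ> inv_into W2 \<psi>2) (f z)" if "z \<in> \<psi>1 ` Q" for z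
    using that MuT W1S by (auto simp: Q_def R_def N3_def fQ invW1 invW2)
  have fsub: "f ` \<psi>1 ` Q \<subseteq> \<psi>2 ` (W2 \<inter> U)" by (auto simp: Q_def R_def fQ)
  have J2': "((\<phi> \<circ> inv_into W2 \<psi>2) has_derivative J2) (at (f (\<psi>1 e)) within \<psi>2 ` (W2 \<inter> U))"
    using J2 unfolding fe .
  have hf: "((\<lambda>z. (\<phi> \<circ> inv_into W2 \<psi>2) (f z)) has_derivative (\<lambda>v. DM (0, J1 v))) (at (\<psi>1 e) within \<psi>1 ` Q)"
    by (rule has_derivative_transform[OF _ _ MuQ]) (use Q hf_eq in auto)
  have contf: "continuous_on (\<psi>1 ` R) f"
  proof -
    have im: "inv_into W1 \<psi>1 ` \<psi>1 ` R = R" using R(2) by (auto simp: invW1 image_iff subset_iff)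
    have "continuous_map (top_of_set (\<psi>1 ` R)) (subtopology ?T1 W1) (inv_into W1 \<psi>1)"
      using continuous_map_from_subtopology_mono[OF chart_inverse_continuous[OF c1] image_mono[OF R(2)]] .
    then have "continuous_map (top_of_set (\<psi>1 ` R)) ?T1 (inv_into W1 \<psi>1)"
      by (simp add: continuous_map_in_subtopology)
    from continuous_map_compose[OF this cont]
    have "continuous_map (top_of_set (\<psi>1 ` R)) (subtopology ?T2 W2) (m g \<circ> inv_into W1 \<psi>1)"
      using im by (auto simp: continuous_map_in_subtopology R_def)
    from continuous_map_compose[OF this chart_continuous[OF c2]]
    show ?thesis by (simp add: f_def o_assoc)
  qed
  \<comment> \<open>Only the composition with the immersion into \<open>C\<close> is known to be
  smooth; differentiability in the fibre charts is obtained by lifting.\<close>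
  have Dex: "\<exists>f'. (f has_derivative f') (at (\<psi>1 e) within \<psi>1 ` Q)"
  proof (rule has_derivative_lift[OF J2' sub(3) _ J2i[rule_format] fsub _ _ hf])
    show "\<psi>2 ` (W2 \<inter> U) \<subseteq> K2" by (auto simp: K2_def intro: span_base)
    show "continuous (at (\<psi>1 e) within \<psi>1 ` Q) f"
      using contf Q(3) by (intro continuous_on_imp_continuous_within[OF continuous_on_subset]) (auto simp: Q_def)
  qed (use Q in auto)
  \<comment> \<open>\<open>Q\<close> is a neighbourhood of the unit in \<open>R\<close>, the
  domain used in \<^const>\<open>diff_rank\<close>.\<close>
  have at_eq: "at (\<psi>1 e) within \<psi>1 ` Q = at (\<psi>1 e) within \<psi>1 ` R"
  proof -
    obtain N where N: "open N" "\<psi>1 ` Q = \<psi>1 ` W1 \<inter> N" by (rule chart_image_openin[OF c1 Q(1,2)])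
    show ?thesis
      by (rule at_within_nhd[of _ N]) (use N Q R(2) in \<open>auto simp: Q_def\<close>)
  qed
  have DL: "(f has_derivative DL) (at (\<psi>1 e) within \<psi>1 ` Q)"
    using Dex unfolding at_eq DL_def by (simp add: frechet_derivative_works[symmetric] differentiable_def)
  have DLK: "DL v \<in> K2" if "v \<in> K1" for v
    by (rule derivative_into_subspace[OF DL sub(3) _ tan that])
      (auto simp: fQ Q_def R_def K2_def intro: span_base)
  have chain: "DM (0, J1 v) = J2 (DL v)" if "v \<in> K1" for v
    by (rule derivative_chain_tangential[OF DL J2' fsub hf _ tan that]) simp
  have DL0: "DL v = 0 \<longleftrightarrow> DM (0, J1 v) = 0" if "v \<in> K1" for v
    using chain[OF that] bspec[OF J2i DLK[OF that]] linear_0[OF lin(3)] by auto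
  have "left_rank g = k \<longleftrightarrow> (\<forall>v\<in>K1. DL v = 0 \<longrightarrow> v = 0)"
    using dim_image_eq_dim_iff[OF has_derivative_linear[OF DL] sub(2)] dims rank by simp
  also have "\<dots> \<longleftrightarrow> (\<forall>v\<in>K1. DM (0, J1 v) = 0 \<longrightarrow> J1 v = 0)"
    using DL0 J1i linear_0[OF lin(2)] by metis
  also have "\<dots> \<longleftrightarrow> (\<forall>w\<in>J1 ` K1. DM (0, w) = 0 \<longrightarrow> w = 0)" by auto
  also have "\<dots> \<longleftrightarrow> (\<forall>v\<in>V1. DG v = 0 \<and> DM (0, v) = 0 \<longrightarrow> v = 0)" unfolding kernel by auto
  finally show ?thesis by (simp add: k_def V1_def)
qed

text \<open>In charts around \<open>g0\<close> and its source unit the criterion of the previous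
lemma concerns the pair \<open>A z\<close> of derivatives at the point \<open>z\<close> with
coordinates of \<open>g\<close> and its source unit. This linear map lives on a space that is
independent of \<open>g\<close> and depends continuously on \<open>z\<close>.\<close>

lemma openin_full_left_rank: "openin (mtop C) {g \<in> points C. left_rank g = mdim C - mdim X}"
proof (subst openin_subopen, intro ballI)
  fix g0 assume "g0 \<in> {g \<in> points C. left_rank g = mdim C - mdim X}"
  then have g0: "g0 \<in> points C" "left_rank g0 = mdim C - mdim X" by auto
  note aC = smooth_manifold_atlas[OF arrows_manifold] and aX = smooth_manifold_atlas[OF objects_manifold]
  have ss: "smooth_map C X s" and st: "smooth_map C X t"
    using source_submersion target_submersion by (auto simp: submersion_def)
  define e where "e g = u (s g)" for g
  have e: "e g \<in> points C" "t (e g) = s g" "m g (e g) = g" if "g \<in> points C" for g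
    using that source_in unit_in target_unit unit_right by (auto simp: e_def)
  have ce: "continuous_map (mtop C) (mtop C) e"
  proof -
    have "continuous_map (mtop C) (mtop X) s" "continuous_map (mtop X) (mtop C) u"
      using ss unit_smooth by (auto simp: smooth_map_on_def)
    then have "continuous_map (mtop C) (mtop C) (u \<circ> s)" by (rule continuous_map_compose)
    then show ?thesis by (simp add: e_def[abs_def] o_def)
  qed
  obtain U \<phi> where U: "(U, \<phi>) \<in> atlas C" "g0 \<in> U" using arrows_manifold g0 unfolding smooth_manifold_def by blast
  obtain U1 \<phi>1 where U1: "(U1, \<phi>1) \<in> atlas C" "e g0 \<in> U1"
    using arrows_manifold e(1)[OF g0(1)] unfolding smooth_manifold_def by blast
  obtain W \<psi> where W: "(W, \<psi>) \<in> atlas X" "s g0 \<in> W"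
    using objects_manifold source_in[OF g0(1)] unfolding smooth_manifold_def by blast
  note cU = smooth_atlas_chart[OF aC U(1)] and cU1 = smooth_atlas_chart[OF aC U1(1)]
    and cW = smooth_atlas_chart[OF aX W(1)]
  note inj = chart_inj_on[OF cU] chart_inj_on[OF cU1]
  let ?S = "\<phi>1 ` {q \<in> U1. t q \<in> W}"
  have "\<phi>1 (e g0) \<in> ?S" using U1 W e(2)[OF g0(1)] by auto
  then obtain N1 G where N1: "open N1" "\<phi>1 (e g0) \<in> N1" and G: "\<And>k. Ck_on k N1 G"
    and "\<And>y. y \<in> ?S \<inter> N1 \<Longrightarrow> (\<psi> \<circ> t \<circ> inv_into U1 \<phi>1) y = G y"
    using smooth_on_extension[OF smooth_map_smooth_on[OF st aC U1(1) W(1)]] by blast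
  then have GT: "G (\<phi>1 q) = \<psi> (t q)" if "q \<in> U1" "t q \<in> W" "\<phi>1 q \<in> N1" for q
    using that inj(2) by force
  let ?P = "{(g, h). g \<in> points C \<and> h \<in> points C \<and> s g = t h}" and ?m = "\<lambda>(g, h). m g h"
  let ?SP = "map_prod \<phi> \<phi>1 ` {x \<in> (U \<times> U1) \<inter> ?P. ?m x \<in> U}"
  have "(U \<times> U1, map_prod \<phi> \<phi>1) \<in> atlas (product_manifold C C)"
    using U U1 by (auto simp: product_manifold_def)
  then have smP: "smooth_on ?SP (\<phi> \<circ> ?m \<circ> inv_into (U \<times> U1) (map_prod \<phi> \<phi>1))"
    using comp_smooth U(1) unfolding smooth_map_on_def by blast
  have inP: "(\<phi> g, \<phi>1 h) \<in> ?SP" if "g \<in> U" "h \<in> U1" "t h = s g" "m g h \<in> U" for g h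
    using that chart_subset[OF cU] chart_subset[OF cU1] by (intro image_eqI[of _ _ "(g, h)"]) auto
  have "(\<phi> g0, \<phi>1 (e g0)) \<in> ?SP" using inP U U1 e g0 by simp
  from smooth_on_extension[OF smP this] obtain N2 Mu where N2: "open N2" "(\<phi> g0, \<phi>1 (e g0)) \<in> N2" and Mu: "\<And>k. Ck_on k N2 Mu"
    and MuP: "\<And>y. y \<in> ?SP \<inter> N2 \<Longrightarrow> (\<phi> \<circ> ?m \<circ> inv_into (U \<times> U1) (map_prod \<phi> \<phi>1)) y = Mu y"
    by blast
  have MuT: "Mu (\<phi> g, \<phi>1 h) = \<phi> (m g h)"
    if "g \<in> U" "h \<in> U1" "t h = s g" "m g h \<in> U" "(\<phi> g, \<phi>1 h) \<in> N2" for g h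
    using MuP[of "(\<phi> g, \<phi>1 h)"] inP that by (simp add: inv_into_map_prod[OF inj])
  define DG where "DG y = frechet_derivative G (at y)" for y
  define DM where "DM z = frechet_derivative Mu (at z)" for z
  have DG: "(G has_derivative DG y) (at y)" if "y \<in> N1" for y
    using G[of 1] that by (auto simp: DG_def frechet_derivative_works)
  have DM: "(Mu has_derivative DM z) (at z)" if "z \<in> N2" for z
    using Mu[of 1] that by (auto simp: DM_def frechet_derivative_works)
  \<comment> \<open>The coordinates where both extended maps are differentiable.\<close>
  define Om where "Om = N2 \<inter> (UNIV \<times> N1)"
  define A where "A z v = (DG (snd z) v, DM z (0, v))" for z v
  define Z where "Z = {z \<in> Om. \<forall>v\<in>span (\<phi>1 ` U1). A z v = 0 \<longrightarrow> v = 0}"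
  have Om: "open Om" unfolding Om_def using N1 N2 by (intro open_Int open_Times) auto
  have Z: "open Z"
    unfolding Z_def
  proof (rule open_injective_on_subspace[OF Om _ _ subspace_span])
    fix z assume z: "z \<in> Om"
    have lin: "linear (DG (snd z))" "linear (DM z)"
      using DG[of "snd z"] DM[of z] z has_derivative_linear by (auto simp: Om_def)
    show "linear (A z)"
    proof (rule linearI)
      show "A z (a + b) = A z a + A z b" for a b
        using linear_add[OF lin(2), of "(0, a)" "(0, b)"] by (simp add: A_def linear_add[OF lin(1)])
      show "A z (r *\<^sub>R a) = r *\<^sub>R A z a" for r a
        using linear_scale[OF lin(2), of r "(0, a)"] by (simp add: A_def linear_scale[OF lin(1)])
    qed
  next
    fix v
    have 1: "continuous_on N1 (\<lambda>y. DG y v)" and 2: "continuous_on N2 (\<lambda>z. DM z (0, v))"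
      using G[of 1] Mu[of 1] by (auto simp: DG_def DM_def)
    have "continuous_on Om (\<lambda>z. DG (snd z) v)"
      by (rule continuous_on_compose2[OF 1]) (auto simp: Om_def intro: continuous_intros)
    moreover have "continuous_on Om (\<lambda>z. DM z (0, v))"
      by (rule continuous_on_subset[OF 2]) (auto simp: Om_def)
    ultimately show "continuous_on Om (\<lambda>z. A z v)" unfolding A_def by (rule continuous_on_Pair)
  qed
  have iff: "left_rank g = mdim C - mdim X \<longleftrightarrow> (\<phi> g, \<phi>1 (e g)) \<in> Z"
    if g: "g \<in> U" "s g \<in> W" "e g \<in> U1" "(\<phi> g, \<phi>1 (e g)) \<in> Om" for g
  proof -
    have gC: "g \<in> points C" using g chart_subset[OF cU] by auto
    have N: "\<phi>1 (e g) \<in> N1" "(\<phi> g, \<phi>1 (e g)) \<in> N2" using g by (auto simp: Om_def)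
    from left_rank_full_iff[OF gC U(1) g(1) U1(1) g(3)[unfolded e_def] W(1) g(2) N1(1) N(1)[unfolded e_def]
        DG[OF N(1), unfolded e_def] GT N2(1) N(2)[unfolded e_def] DM[OF N(2), unfolded e_def] MuT[OF g(1)]]
    have "left_rank g = mdim C - mdim X \<longleftrightarrow>
      (\<forall>v\<in>span (\<phi>1 ` U1). DG (\<phi>1 (e g)) v = 0 \<and> DM (\<phi> g, \<phi>1 (e g)) (0, v) = 0 \<longrightarrow> v = 0)"
      unfolding e_def by blast
    then show ?thesis using g(4) by (auto simp: Z_def A_def zero_prod_def)
  qed
  define T where "T = {g \<in> U. s g \<in> W} \<inter> (U \<inter> {g \<in> points C. e g \<in> U1})"
  have T: "openin (mtop C) T" unfolding T_def
    by (intro openin_Int smooth_map_openin[OF ss] chart_openin[OF cU] chart_openin[OF cW]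
        openin_continuous_map_preimage[OF ce] chart_openin[OF cU1])
  define T' where "T' = {g \<in> T. (\<phi> g, \<phi>1 (e g)) \<in> Z}"
  have "continuous_map (subtopology (mtop C) T) euclidean (\<lambda>g. (\<phi> g, \<phi>1 (e g)))"
  proof -
    have "continuous_map (subtopology (mtop C) T) euclidean \<phi>"
      by (rule continuous_map_from_subtopology_mono[OF chart_continuous[OF cU]]) (auto simp: T_def)
    moreover have "continuous_map (subtopology (mtop C) T) (subtopology (mtop C) U1) e"
      using continuous_map_from_subtopology[OF ce, of T] by (auto simp: continuous_map_in_subtopology T_def)
    from continuous_map_compose[OF this chart_continuous[OF cU1]]
    have "continuous_map (subtopology (mtop C) T) euclidean (\<lambda>g. \<phi>1 (e g))" by (simp add: o_def)
    ultimately have "continuous_map (subtopology (mtop C) T) (prod_topology euclidean euclidean) (\<lambda>g. (\<phi> g, \<phi>1 (e g)))"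
      by (rule continuous_map_pairedI)
    then show ?thesis by (simp add: euclidean_product_topology)
  qed
  from openin_continuous_map_preimage[OF this, of Z] Z
  have "openin (subtopology (mtop C) T) {g \<in> topspace (subtopology (mtop C) T). (\<phi> g, \<phi>1 (e g)) \<in> Z}" by simp
  moreover have "topspace (subtopology (mtop C) T) = T" using openin_subset[OF T] by auto
  ultimately have "openin (mtop C) T'" unfolding T'_def using T openin_trans_full by fastforce
  moreover have "g0 \<in> T'"
    using iff[OF U(2) W(2) U1(2)] g0 U U1 W N1 N2 by (auto simp: T'_def T_def Om_def)
  moreover have "T' \<subseteq> {g \<in> points C. left_rank g = mdim C - mdim X}"
    using iff chart_subset[OF cU] by (auto simp: T'_def T_def Z_def)
  ultimately show "\<exists>T. openin (mtop C) T \<and> g0 \<in> T \<and> T \<subseteq> {g \<in> points C. left_rank g = mdim C - mdim X}"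
    by blast
qed

text \<open>Right translations are the left translations of the opposite category.\<close>

lemma opposite_lie_category: "lie_category C X t s u (\<lambda>g h. m h g)"
proof -
  let ?P = "{(g, h). g \<in> points C \<and> h \<in> points C \<and> s g = t h}"
  let ?Q = "{(g, h). g \<in> points C \<and> h \<in> points C \<and> t g = s h}"
  let ?CC = "product_manifold C C"
  note aC = smooth_manifold_atlas[OF arrows_manifold]
  have smooth: "smooth_on (\<Phi> ` {x \<in> Y \<inter> ?Q. (\<lambda>(g, h). m h g) x \<in> Z}) (\<zeta> \<circ> (\<lambda>(g, h). m h g) \<circ> inv_into Y \<Phi>)"
    if Y: "(Y, \<Phi>) \<in> atlas ?CC" and Z: "(Z, \<zeta>) \<in> atlas C" for Y \<Phi> Z \<zeta>
  proof -
    obtain U \<phi> W \<psi> where UW: "Y = U \<times> W" "\<Phi> = map_prod \<phi> \<psi>" "(U, \<phi>) \<in> atlas C" "(W, \<psi>) \<in> atlas C"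
      using Y by (auto simp: product_manifold_def)
    note inj = chart_inj_on[OF smooth_atlas_chart[OF aC UW(3)]] chart_inj_on[OF smooth_atlas_chart[OF aC UW(4)]]
    let ?A = "map_prod \<phi> \<psi> ` {x \<in> (U \<times> W) \<inter> ?Q. (\<lambda>(g, h). m h g) x \<in> Z}"
    let ?B = "map_prod \<psi> \<phi> ` {x \<in> (W \<times> U) \<inter> ?P. (\<lambda>(g, h). m g h) x \<in> Z}"
    have "(W \<times> U, map_prod \<psi> \<phi>) \<in> atlas ?CC" using UW by (auto simp: product_manifold_def)
    then have B: "smooth_on ?B (\<zeta> \<circ> (\<lambda>(g, h). m g h) \<circ> inv_into (W \<times> U) (map_prod \<psi> \<phi>))"
      using comp_smooth Z unfolding smooth_map_on_def by blast
    have lin: "linear (\<lambda>x :: 'e \<times> 'e. (snd x, fst x))" by (intro linearI) auto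
    have "smooth_on ?A (\<lambda>x. (snd x, fst x))"
      by (rule smooth_onI_Ck[of UNIV]) (auto intro: Ck_on_linear lin)
    then have "smooth_on ?A (\<lambda>x. (\<zeta> \<circ> (\<lambda>(g, h). m g h) \<circ> inv_into (W \<times> U) (map_prod \<psi> \<phi>)) (snd x, fst x))"
      by (rule smooth_on_compose[OF _ B]) (force simp: image_iff)
    then show ?thesis unfolding UW(1,2)
      by (rule smooth_on_cong) (auto simp: inv_into_map_prod[OF inj] inv_into_map_prod[OF inj(2,1)])
  qed
  have "continuous_map (subtopology (prod_topology (mtop C) (mtop C)) ?Q)
      (prod_topology (mtop C) (mtop C)) (\<lambda>x. (snd x, fst x))"
    by (intro continuous_map_from_subtopology continuous_map_pairedI continuous_map_fst continuous_map_snd)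
  then have "continuous_map (subtopology (prod_topology (mtop C) (mtop C)) ?Q)
      (subtopology (prod_topology (mtop C) (mtop C)) ?P) (\<lambda>x. (snd x, fst x))"
    by (auto simp: continuous_map_in_subtopology)
  moreover have "continuous_map (subtopology (prod_topology (mtop C) (mtop C)) ?P) (mtop C) (\<lambda>(g, h). m g h)"
    using comp_smooth by (simp add: smooth_map_on_def product_manifold_def)
  ultimately have "continuous_map (subtopology (prod_topology (mtop C) (mtop C)) ?Q) (mtop C)
      ((\<lambda>(g, h). m g h) \<circ> (\<lambda>x. (snd x, fst x)))"
    by (rule continuous_map_compose)
  then have "continuous_map (subtopology (mtop ?CC) ?Q) (mtop C) (\<lambda>(g, h). m h g)"
    by (simp add: product_manifold_def o_def case_prod_unfold)
  then have "smooth_map_on ?CC ?Q C (\<lambda>(g, h). m h g)"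
    unfolding smooth_map_on_def using smooth by blast
  note comp' = this
  show ?thesis
  proof (intro lie_category.intro small_category.intro lie_category_axioms.intro)
    fix g h k assume "g \<in> points C" "h \<in> points C" "k \<in> points C" "t g = s h" "t h = s k"
    then show "m k (m h g) = m (m k h) g" using comp_assoc[of k h g] by simp
  next
    fix g h assume "g \<in> points C" "h \<in> points C" "t g = s h"
    then show "m h g \<in> points C" "t (m h g) = t h" "s (m h g) = s g"
      using comp_in[of h g] target_comp[of h g] source_comp[of h g] by auto
  qed (fact source_in target_in unit_in source_unit target_unit unit_left unit_right arrows_manifold
      objects_manifold objects_no_boundary source_submersion target_submersion
      source_boundary_submersion target_boundary_submersion unit_smooth comp')+
qed

text \<open>Target fibres of the opposite category are source fibres, so its left rank is the right rank.\<close>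

lemma openin_regular: "openin (mtop C) {g \<in> points C. regular g}"
proof -
  interpret op: lie_category C X t s u "\<lambda>g h. m h g" by (rule opposite_lie_category)
  have "op.target_fibre = source_fibre" by (simp add: op.target_fibre_def source_fibre_def fun_eq_iff)
  then have "op.left_rank = right_rank" by (simp add: op.left_rank_def right_rank_def fun_eq_iff)
  with op.openin_full_left_rank openin_full_left_rank
  have "openin (mtop C) ({g \<in> points C. left_rank g = mdim C - mdim X} \<inter>
      {g \<in> points C. right_rank g = mdim C - mdim X})"
    by (intro openin_Int) auto
  also have "\<dots> = {g \<in> points C. regular g}" by (auto simp: regular_def)
  finally show ?thesis .
qed

end

theorem proposition2:
  fixes C :: "('c, 'e::euclidean_space) manifold" and X :: "('x, 'f::euclidean_space) manifold"
    and s t :: "'c \<Rightarrow> 'x" and u :: "'x \<Rightarrow> 'c" and m :: "'c \<Rightarrow> 'c \<Rightarrow> 'c"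
  assumes "lie_category C X s t u m"
  shows "openin (mtop C) {g \<in> points C. lie_category.regular C X s t u m g}"
proof -
  interpret lie_category C X s t u m by (rule assms)
  show ?thesis by (rule openin_regular)
qed

end
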